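(* Let $d\ge1$ and $\mathcal P=\{P^j\}_{j=1}^d$, $P^j=\{p^j_i\}_{i=1}^\infty$ sequences of natural numbers different from $1$ with $\sup_{i\in\mathbb N,\,1\le j\le d}p^j_i<\infty$. Consider the multiple generalized Haar series $$\sum_{\bar n\in\mathbb Z_+^d}a_{\bar n}\chi^{\mathcal P}_{\bar n}(x),\qquad \chi^{\mathcal P}_{\bar n}(x)=\chi^1_{n_1}(x_1)\cdots\chi^d_{n_d}(x_d),$$ and suppose that its $\mathcal P$-ary partial sums $S_N(x)=\sum_{\bar n<\tilde N}a_{\bar n}\chi^{\mathcal P}_{\bar n}(x)$ converge almost everywhere on $[0,1]^d$ to a function $f(x)$. Let $\Psi$ be the associated additive function and $\Psi^*$ its majorant (defined below). Suppose there exist measurable functions $h_m:[0,1]^d\to\mathbb R$ ($m\in\mathbb N$) such that: (i) $0\le h_1(x)\le h_2(x)\le\dots$ and $\lim_{m\to\infty}h_m(x)=\infty$; (ii) there is $C>0$ such that for every $m$ there are $I^m_1,\dots,I^m_{n_m}\in\Lambda^d$ with pairwise disjoint interiors and union $[0,1]^d$, with $\sup_{x\in I^m_k}h_m(x)\le C\inf_{x\in I^m_k}h_m(x)$ for all $m$, $1\le k\le n_m$; (iii) $\inf_{m,k}\int_{I^m_k}h_m(x)\,dx>0$; and $$\lim_{m\to\infty}\int_{\{x\in[0,1]^d:\ \Psi^*(x)>h_m(x)\}}h_m(x)\,dx=0.$$ Then for every $\bar n=(n_1,\dots,n_d)\in\mathbb Z_+^d$, $$a_{\bar n}=\lim_{m\to\infty}\int_{[0,1]^d}\Big[f(x)\overline{\chi^{\mathcal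 P}_{\bar n}(x)}\Big]_{h^{\bar n}_m(x)}dx,\qquad h^{\bar n}_m(x)=\|\chi^{\mathcal P}_{\bar n}\|_\infty h_m(x).$$
   Context: For a sequence $P=\{p_i\}$ of naturals $\ge2$, $m_0=1$, $m_k=\prod_{i=1}^k p_i$; each $x\in[0,1)$ is written $x=\sum_{j\ge1}x_j/m_j$ with integer digits $0\le x_j\le p_j-1$, choosing the finite expansion for points of the form $l/m_n$. The generalized Haar system $\{\chi_n\}_{n\ge0}$ for $P$: $\chi_0\equiv1$, and for $n\ge1$ write $n=m_k+r(p_{k+1}-1)+s-1$ with $0\le r\le m_k-1$, $1\le s\le p_{k+1}-1$; then $\chi_n(x)=\sqrt{m_k}\,e^{2\pi i x_{k+1}s/p_{k+1}}$ for $x\in[r/m_k,(r+1)/m_k)$ and $\chi_n(x)=0$ otherwise on $[0,1)$. $\chi^j_n$ denotes this system for $P^j$. For $\bar n,\bar k$, $\bar n<\bar k$ means $0\le n_j<m^j_{k_j}$ for all $j$, where $m^j_k=\prod_{i=1}^kp^j_i$; $\tilde N=(N,\dots,N)$. $\Lambda^d_k$ is the set of parallelepipeds $\prod_{j=1}^d[n_j/m^j_k,(n_j+1)/m^j_k]$, $n_j\in\mathbb Z$, and $\Lambda^d=\bigcup_{k\ge0}\Lambda^d_k$. The associated additive function is $\Psi(I)=\lim_{N\to\infty}\int_I S_N(x)\,dx$ for $I\in\Lambda^d$ (the limit exists since it stabilizes). A point $x$ is $\mathcal P$-irrational if $x_j\prod_{i=1}^np^j_i\notin\mathbb Z$ for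 all $j$ and $n$; for such $x$, $\Psi^*(x)=\sup_{I:\,x\in I\in\Lambda^d}|\Psi(I)|/\mu(I)$ ($\mu$ Lebesgue measure). Truncation: $[g(x)]_{\lambda(x)}=g(x)$ if $|g(x)|\le\lambda(x)$, and $0$ otherwise. *)

theory Defs
  imports "HOL-Analysis.Analysis"
begin

text \<open>One-dimensional generalized Haar system for a sequence p = (p 1, p 2, ...)
  (p 0 is unused).\<close>

definition mprod :: "(nat \<Rightarrow> nat) \<Rightarrow> nat \<Rightarrow> nat" where
  "mprod p k = (\<Prod>i = 1..k. p i)"

text \<open>The k-th digit (k \<ge> 1) of x in [0,1) in the mixed-radix expansion,
  finite expansion chosen for P-rational points.\<close>
definition digit :: "(nat \<Rightarrow> nat) \<Rightarrow> nat \<Rightarrow> real \<Rightarrow> nat" where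
  "digit p k x = nat \<lfloor>x * real (mprod p k)\<rfloor> mod p k"

definition haar_level :: "(nat \<Rightarrow> nat) \<Rightarrow> nat \<Rightarrow> nat" where
  "haar_level p n = (LEAST k. n < mprod p (Suc k))"

definition haar :: "(nat \<Rightarrow> nat) \<Rightarrow> nat \<Rightarrow> real \<Rightarrow> complex" where
  "haar p n x =
    (if n = 0 then 1 else
      (let k = haar_level p n; q = n - mprod p k;
           r = q div (p (Suc k) - 1); s = q mod (p (Suc k) - 1) + 1
       in if real r / real (mprod p k) \<le> x \<and> x < (real r + 1) / real (mprod p k)
          then complex_of_real (sqrt (real (mprod p k))) *
               exp (2 * complex_of_real pi * \<i> * of_nat (digit p (Suc k) x) * of_nat s
                    / of_nat (p (Suc k)))
          else 0))"

definition haar_multi :: "('n::finite \<Rightarrow> nat \<Rightarrow> nat) \<Rightarrow> ('n \<Rightarrow> nat) \<Rightarrow> real^'n \<Rightarrow> complex" where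
  "haar_multi P n x = (\<Prod>j\<in>UNIV. haar (P j) (n j) (x $ j))"

definition haar_supnorm :: "('n::finite \<Rightarrow> nat \<Rightarrow> nat) \<Rightarrow> ('n \<Rightarrow> nat) \<Rightarrow> real" where
  "haar_supnorm P n = (SUP x\<in>cbox 0 1. norm (haar_multi P n x))"

definition haar_psum :: "('n::finite \<Rightarrow> nat \<Rightarrow> nat) \<Rightarrow> (('n \<Rightarrow> nat) \<Rightarrow> complex) \<Rightarrow> nat \<Rightarrow> real^'n \<Rightarrow> complex" where
  "haar_psum P a N x = (\<Sum>n\<in>{n. \<forall>j. n j < mprod (P j) N}. a n * haar_multi P n x)"

definition Lambda_k :: "('n::finite \<Rightarrow> nat \<Rightarrow> nat) \<Rightarrow> nat \<Rightarrow> (real^'n) set set" where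
  "Lambda_k P k = {cbox (\<chi> j. real_of_int (c j) / real (mprod (P j) k))
                        (\<chi> j. (real_of_int (c j) + 1) / real (mprod (P j) k)) | c :: 'n \<Rightarrow> int. True}"

definition Lambda :: "('n::finite \<Rightarrow> nat \<Rightarrow> nat) \<Rightarrow> (real^'n) set set" where
  "Lambda P = (\<Union>k. Lambda_k P k)"

definition haar_Psi :: "('n::finite \<Rightarrow> nat \<Rightarrow> nat) \<Rightarrow> (('n \<Rightarrow> nat) \<Rightarrow> complex) \<Rightarrow> (real^'n) set \<Rightarrow> complex" where
  "haar_Psi P a I = lim (\<lambda>N. set_lebesgue_integral lebesgue I (haar_psum P a N))"

definition P_irrational :: "('n::finite \<Rightarrow> nat \<Rightarrow> nat) \<Rightarrow> real^'n \<Rightarrow> bool" where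
  "P_irrational P x = (\<forall>j n. x $ j * real (mprod (P j) n) \<notin> \<int>)"

text \<open>Majorant; set to 0 at non-P-irrational points (a null set), where the paper leaves it undefined.\<close>
definition haar_Psi_star :: "('n::finite \<Rightarrow> nat \<Rightarrow> nat) \<Rightarrow> (('n \<Rightarrow> nat) \<Rightarrow> complex) \<Rightarrow> real^'n \<Rightarrow> ereal" where
  "haar_Psi_star P a x =
     (if P_irrational P x
      then (SUP I\<in>{I \<in> Lambda P. x \<in> I}. ereal (norm (haar_Psi P a I) / measure lebesgue I))
      else 0)"

definition trunc :: "complex \<Rightarrow> real \<Rightarrow> complex" where
  "trunc g l = (if norm g \<le> l then g else 0)"

end

theory Submission
  imports Defs
begin

text \<open>The partial sums \<open>S N\<close> are constant on the half-open cells of level \<open>N\<close>, and the integral of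
  \<open>S M\<close> over such a cell is the same for all \<open>M \<ge> N\<close>. So \<open>S\<close> is a martingale for the filtration of
  cells, and at irrational points \<open>\<Psi>\<^sup>*\<close> dominates all \<open>\<bar>S N\<bar>\<close>. Let \<open>E = {h m < \<Psi>\<^sup>*}\<close>. By (ii) and (iii),
  for large \<open>m\<close> the set \<open>E\<close> fills only a small proportion of every cell of the \<open>m\<close>-th partition, also after
  that partition is refined so that the given Haar function is constant on its cells.

  Inside such a cell stop the martingale as soon as the proportion of \<open>E\<close> in the current cell exceeds
  \<open>\<gamma>\<close>. Since the branching numbers are bounded, \<open>\<gamma>\<close> can be so small that even a cell at which one
  stops is not covered by \<open>E\<close>. Hence the stopped martingale is bounded by the size of \<open>h m\<close> on the cell,
  dominated convergence applies to it, and its limit differs from \<open>f\<close> only on a set whose measure is at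
  most that of \<open>E\<close> divided by \<open>\<gamma>\<close>. Summed over the cells, the error is at most a constant times
  the integral of \<open>h m\<close> over \<open>E\<close>.\<close>

subsection \<open>Generalized Haar functions of one variable\<close>

lemma mprod_0 [simp]: "mprod p 0 = 1"
  by (simp add: mprod_def)

lemma mprod_Suc: "mprod p (Suc k) = mprod p k * p (Suc k)"
  by (simp add: mprod_def)

lemma mprod_dvd: "k \<le> l \<Longrightarrow> mprod p k dvd mprod p l"
  by (induction rule: dec_induct) (auto simp: mprod_Suc)

text \<open>Division by a positive integer may be done after rounding down, so the position on a
  fine grid determines the position on a coarser one. All nesting of intervals and cells rests on
  this.\<close>

lemma floor_mult_eq_floor_div:
  fixes x :: real
  assumes "m > 0" "m dvd m'" "m' > 0"
  shows "\<lfloor>x * real m\<rfloor> = \<lfloor>x * real m'\<rfloor> div int (m' div m)"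
proof -
  obtain q where q: "m' = m * q" using assms(2) by blast
  then have "q > 0" using assms by (auto intro: Nat.gr0I)
  have "\<lfloor>x * real m' / real_of_int (int q)\<rfloor> = \<lfloor>x * real m'\<rfloor> div int q"
    by (rule floor_divide_real_eq_div) simp
  moreover have "x * real m' / real_of_int (int q) = x * real m"
    using \<open>q > 0\<close> by (simp add: q)
  ultimately show ?thesis using assms(1) by (simp add: q)
qed

text \<open>A floor equation instead of end points turns nesting into integer arithmetic. The
  half-open shape makes the intervals of one level a genuine partition.\<close>

definition icell :: "nat \<Rightarrow> int \<Rightarrow> real set" where
  "icell m c = {x. \<lfloor>x * real m\<rfloor> = c}"

lemma icell_eq:
  assumes "m > 0"
  shows "icell m c = {real_of_int c / real m ..< (real_of_int c + 1) / real m}"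
  using assms by (auto simp: icell_def floor_eq_iff field_simps)

lemma icell_sets [measurable]: "icell m c \<in> sets borel"
  unfolding icell_def by measurable

lemma measure_icell: "m > 0 \<Longrightarrow> measure lborel (icell m c) = 1 / real m"
  by (simp add: icell_eq divide_right_mono) (simp add: diff_divide_distrib[symmetric])

lemma emeasure_icell: "m > 0 \<Longrightarrow> emeasure lborel (icell m c) = ennreal (1 / real m)"
  by (simp add: icell_eq divide_right_mono) (simp add: diff_divide_distrib[symmetric])

lemma icell_split:
  assumes "m > 0" "p > 0"
  shows "icell m c = (\<Union>t<p. icell (m * p) (c * int p + int t))"
proof -
  have *: "\<lfloor>x * real m\<rfloor> = \<lfloor>x * real (m * p)\<rfloor> div int p" for x
    using floor_mult_eq_floor_div[of m "m * p" x] assms by simp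
  have "x div int p = c \<longleftrightarrow> (\<exists>t<p. x = c * int p + int t)" for x
  proof
    assume "x div int p = c"
    then have "x = c * int p + int (nat (x mod int p)) \<and> nat (x mod int p) < p"
      using assms by (auto simp: nat_less_iff mult.commute)
    then show "\<exists>t<p. x = c * int p + int t" by blast
  qed auto
  then show ?thesis by (auto simp: icell_def *)
qed

text \<open>The next digit takes each of its values on exactly one of the \<open>p (Suc k)\<close>
  equal subintervals, so the integral becomes a sum over digit values.\<close>

lemma set_integral_icell_digit:
  fixes G :: "nat \<Rightarrow> complex"
  assumes "mprod p k > 0" "p (Suc k) > 0"
  shows "set_lebesgue_integral lborel (icell (mprod p k) (int r)) (\<lambda>x. G (digit p (Suc k) x))
         = (\<Sum>t<p (Suc k). G t) / of_nat (mprod p (Suc k))"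
proof -
  let ?q = "p (Suc k)" and ?M = "mprod p (Suc k)"
  let ?J = "\<lambda>t. icell ?M (int r * int ?q + int t)"
  have M: "?M > 0" using assms by (simp add: mprod_Suc)
  have dig: "digit p (Suc k) x = t" if "x \<in> ?J t" "t < ?q" for x t
  proof -
    have "\<lfloor>x * real ?M\<rfloor> = int (r * ?q + t)" using that by (simp add: icell_def)
    then show ?thesis using that(2) unfolding digit_def by (simp only: nat_int) simp
  qed
  have eq: "indicator (icell (mprod p k) (int r)) x *\<^sub>R G (digit p (Suc k) x)
      = (\<Sum>t<?q. indicator (?J t) x *\<^sub>R G t)" for x
  proof (cases "x \<in> icell (mprod p k) (int r)")
    case True
    then obtain t where t: "t < ?q" "x \<in> ?J t"
      using icell_split[OF assms(1,2), of "int r"] by (auto simp: mprod_Suc)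
    have "(\<Sum>t<?q. indicator (?J t) x *\<^sub>R G t) = (\<Sum>t'<?q. if t' = t then G t else 0)"
      using t by (intro sum.cong) (auto simp: icell_def indicator_def)
    then show ?thesis using True t dig by simp
  next
    case False
    then have "x \<notin> ?J t" if "t < ?q" for t
      using icell_split[OF assms(1,2), of "int r"] that by (auto simp: mprod_Suc)
    then show ?thesis using False by simp
  qed
  have int: "integrable lborel (\<lambda>x. indicator (?J t) x *\<^sub>R G t)" for t
    using emeasure_icell[OF M] by (intro integrable_scaleR_left) (auto simp: integrable_indicator_iff)
  have "(LINT x|lborel. indicator (?J t) x *\<^sub>R G t) = G t / of_nat ?M" for t
    using measure_icell[OF M] emeasure_icell[OF M]
    by (subst integral_scaleR_left) (auto simp: integrable_indicator_iff scaleR_conv_of_real)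
  then show "set_lebesgue_integral lborel (icell (mprod p k) (int r)) (\<lambda>x. G (digit p (Suc k) x))
         = (\<Sum>t<p (Suc k). G t) / of_nat (mprod p (Suc k))"
    unfolding set_lebesgue_integral_def eq using int
    by (subst Bochner_Integration.integral_sum) (auto simp: sum_divide_distrib)
qed

section \<open>Sums of roots of unity\<close>

definition unit_root :: "nat \<Rightarrow> int \<Rightarrow> nat \<Rightarrow> complex" where
  "unit_root q u t = exp (2 * complex_of_real pi * \<i> * of_nat t * of_int u / of_nat q)"

text \<open>This is a geometric sum whose ratio \<open>w\<close> is a \<open>q\<close>-th root of
  unity. The divisibility hypothesis is what excludes \<open>w = 1\<close>.\<close>

lemma sum_unit_root:
  assumes "\<not> int q dvd u" "q > 0"
  shows "(\<Sum>t<q. unit_root q u t) = 0"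
proof -
  define w where "w = exp (2 * complex_of_real pi * \<i> * of_int u / of_nat q)"
  have pow: "unit_root q u t = w ^ t" for t
    unfolding unit_root_def w_def exp_of_nat_mult[symmetric] by (simp add: algebra_simps)
  have "w \<noteq> 1"
  proof
    assume "w = 1"
    then obtain n :: int where "2 * pi * real_of_int u / real q = of_int (2 * n) * pi"
      unfolding w_def exp_eq_1 by auto
    then have "real_of_int u = real_of_int (n * int q)"
      using assms(2) by (simp add: field_simps)
    then have "u = n * int q" by (simp only: of_int_eq_iff)
    then show False using assms(1) by simp
  qed
  moreover have "w ^ q = 1"
  proof -
    have "w ^ q = exp (2 * complex_of_real pi * \<i> * of_int u)"
      unfolding w_def exp_of_nat_mult[symmetric] using assms(2) by simp
    also have "\<dots> = 1"
      unfolding exp_eq_1 by (auto intro!: exI[of _ u])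
    finally show ?thesis .
  qed
  ultimately show ?thesis unfolding pow by (simp add: geometric_sum)
qed

lemma unit_root_0 [simp]: "unit_root q 0 t = 1"
  by (simp add: unit_root_def)

text \<open>Products of two Haar functions with the same support reduce to a single character this
  way. The difference may be negative, hence the integer frequencies.\<close>

lemma unit_root_mult_cnj: "unit_root q u t * cnj (unit_root q v t) = unit_root q (u - v) t"
  unfolding unit_root_def exp_cnj exp_add[symmetric] by (simp add: field_simps diff_divide_distrib)

lemma norm_unit_root [simp]: "norm (unit_root q u t) = 1"
  by (simp add: unit_root_def)

section \<open>Level, shift and frequency of an index\<close>

locale radix =
  fixes p :: "nat \<Rightarrow> nat"
  assumes ge2: "\<And>i. 1 \<le> i \<Longrightarrow> 2 \<le> p i"
begin

lemma p_pos: "p (Suc k) > 0" and p_gt1: "p (Suc k) > 1"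
  using ge2[of "Suc k"] by auto

lemma mprod_pos: "mprod p k > 0"
  using p_pos by (induction k) (auto simp: mprod_Suc)

lemma mprod_less_Suc: "mprod p k < mprod p (Suc k)"
  using mprod_pos p_gt1[of k] by (simp add: mprod_Suc)

lemma mprod_mono: "k \<le> l \<Longrightarrow> mprod p k \<le> mprod p l"
  by (rule dvd_imp_le[OF mprod_dvd mprod_pos])

lemma mprod_gt: "k < mprod p k"
proof (induction k)
  case (Suc k)
  then show ?case using mprod_less_Suc[of k] by linarith
qed simp

lemma floor_mprod_mono:
  assumes "k \<le> l" "\<lfloor>x * real (mprod p l)\<rfloor> = \<lfloor>y * real (mprod p l)\<rfloor>"
  shows "\<lfloor>x * real (mprod p k)\<rfloor> = \<lfloor>y * real (mprod p k)\<rfloor>"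
  using assms floor_mult_eq_floor_div[OF mprod_pos mprod_dvd mprod_pos] by metis

text \<open>\<open>shift n\<close> and \<open>freq n\<close> are the paper's \<open>r\<close> and \<open>s\<close> in \<open>n = m k + r * (p (Suc k) - 1) + s - 1\<close>.\<close>

definition shift :: "nat \<Rightarrow> nat" where
  "shift n = (n - mprod p (haar_level p n)) div (p (Suc (haar_level p n)) - 1)"

definition freq :: "nat \<Rightarrow> nat" where
  "freq n = (n - mprod p (haar_level p n)) mod (p (Suc (haar_level p n)) - 1) + 1"

lemma haar_level_bounds:
  assumes "n > 0"
  shows "mprod p (haar_level p n) \<le> n" "n < mprod p (Suc (haar_level p n))"
proof -
  have "n < mprod p (Suc n)" using mprod_gt[of "Suc n"] by simp
  then show *: "n < mprod p (Suc (haar_level p n))" unfolding haar_level_def by (rule LeastI)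
  show "mprod p (haar_level p n) \<le> n"
  proof (cases "haar_level p n")
    case 0 then show ?thesis using assms by simp
  next
    case (Suc k)
    then have "\<not> n < mprod p (Suc k)" unfolding haar_level_def by (intro not_less_Least) simp
    then show ?thesis using Suc by simp
  qed
qed

lemma haar_level_less:
  assumes "n > 0" "n < mprod p N" shows "haar_level p n < N"
proof (rule ccontr)
  assume "\<not> ?thesis"
  then have "mprod p N \<le> mprod p (haar_level p n)" by (intro mprod_mono) simp
  then show False using haar_level_bounds[OF assms(1)] assms(2) by simp
qed

lemma haar_level_ge:
  assumes "mprod p N \<le> n" shows "N \<le> haar_level p n"
proof (rule ccontr)
  assume "\<not> ?thesis"
  then have "mprod p (Suc (haar_level p n)) \<le> mprod p N" by (intro mprod_mono) simp
  moreover have "n > 0" using assms mprod_pos[of N] by simp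
  ultimately show False using haar_level_bounds[of n] assms by simp
qed

lemma freq_bounds: "0 < freq n" "freq n < p (Suc (haar_level p n))"
proof -
  have "(n - mprod p (haar_level p n)) mod (p (Suc (haar_level p n)) - 1) < p (Suc (haar_level p n)) - 1"
    using p_gt1[of "haar_level p n"] by (intro mod_less_divisor) simp
  then show "0 < freq n" "freq n < p (Suc (haar_level p n))" by (auto simp: freq_def)
qed

text \<open>Level, shift and frequency together determine the index. Orthogonality uses this to see
  that distinct indices with equal level and shift differ in frequency.\<close>

lemma index_decomp:
  assumes "n > 0"
  shows "n = mprod p (haar_level p n) + shift n * (p (Suc (haar_level p n)) - 1) + freq n - 1"
  using haar_level_bounds(1)[OF assms] div_mult_mod_eq[of "n - mprod p (haar_level p n)"]
  unfolding shift_def freq_def by (metis add.assoc add_diff_cancel_right' le_add_diff_inverse)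

lemma shift_less:
  assumes "n > 0" shows "shift n < mprod p (haar_level p n)"
proof -
  let ?k = "haar_level p n"
  have "n - mprod p ?k < mprod p ?k * (p (Suc ?k) - 1)"
    using haar_level_bounds[OF assms] by (simp add: mprod_Suc algebra_simps diff_mult_distrib2)
  then show ?thesis by (simp add: shift_def less_mult_imp_div_less)
qed

lemma haar_eq:
  assumes "n > 0"
  shows "haar p n x = indicator (icell (mprod p (haar_level p n)) (int (shift n))) x *\<^sub>R
    (complex_of_real (sqrt (real (mprod p (haar_level p n)))) *
     unit_root (p (Suc (haar_level p n))) (int (freq n)) (digit p (Suc (haar_level p n)) x))"
  using assms mprod_pos[of "haar_level p n"]
  by (auto simp: haar_def Let_def icell_eq shift_def freq_def unit_root_def indicator_def)

lemma haar_0 [simp]: "haar p 0 x = 1"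
  by (simp add: haar_def)

text \<open>A nonzero index of this size has level below \<open>N\<close>, so the function depends
  only on the interval of its own level and on the next digit; both can be read off from the grid of
  level \<open>N\<close>.\<close>

lemma haar_const:
  assumes "n < mprod p N" "\<lfloor>x * real (mprod p N)\<rfloor> = \<lfloor>y * real (mprod p N)\<rfloor>"
  shows "haar p n x = haar p n y"
proof (cases "n = 0")
  case False
  then have k: "haar_level p n < N" using haar_level_less assms(1) by simp
  then have "\<lfloor>x * real (mprod p (haar_level p n))\<rfloor> = \<lfloor>y * real (mprod p (haar_level p n))\<rfloor>"
    "\<lfloor>x * real (mprod p (Suc (haar_level p n)))\<rfloor> = \<lfloor>y * real (mprod p (Suc (haar_level p n)))\<rfloor>"
    using floor_mprod_mono assms(2) by (meson less_imp_le Suc_leI)+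
  then show ?thesis using False by (simp add: haar_eq icell_def digit_def indicator_def)
qed simp

lemma haar_measurable [measurable]: "haar p n \<in> borel_measurable borel"
proof (cases "n = 0")
  case False
  have "digit p k \<in> measurable borel (count_space UNIV)" for k
    unfolding digit_def by measurable
  moreover have "haar p n = (\<lambda>x. indicator (icell (mprod p (haar_level p n)) (int (shift n))) x *\<^sub>R
    (complex_of_real (sqrt (real (mprod p (haar_level p n)))) *
     unit_root (p (Suc (haar_level p n))) (int (freq n)) (digit p (Suc (haar_level p n)) x)))"
    using False haar_eq by blast
  ultimately show ?thesis by simp
next
  case True
  then have "haar p n = (\<lambda>x. 1)" by auto
  then show ?thesis by simp
qed

lemma norm_haar_le: "norm (haar p n x) \<le> sqrt (real (mprod p (haar_level p n)))"
proof (cases "n = 0")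
  case True
  then show ?thesis using mprod_pos[of "haar_level p n"] by simp
next
  case False
  then show ?thesis by (simp add: haar_eq norm_mult split: split_indicator)
qed

section \<open>Cancellation and orthonormality in one variable\<close>

lemma icell_nested:
  assumes "k \<le> l"
  shows "icell (mprod p l) c' \<subseteq> icell (mprod p k) c \<or> icell (mprod p l) c' \<inter> icell (mprod p k) c = {}"
proof -
  have "x \<in> icell (mprod p k) c" if "x \<in> icell (mprod p l) c'" "y \<in> icell (mprod p l) c'" "y \<in> icell (mprod p k) c" for x y
    using floor_mprod_mono[OF assms, of x y] that by (simp add: icell_def)
  then show ?thesis by blast
qed

text \<open>On its support the function is a constant times a character of the next digit. The
  frequency lies strictly between 0 and the radix, so the character sums to zero over the
  digits.\<close>

lemma set_integral_support_haar:
  assumes "n > 0"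
  shows "set_lebesgue_integral lborel (icell (mprod p (haar_level p n)) (int (shift n))) (haar p n) = 0"
proof -
  let ?k = "haar_level p n"
  have nd: "\<not> int (p (Suc ?k)) dvd int (freq n)"
    using freq_bounds[of n] nat_dvd_not_less by auto
  have "set_lebesgue_integral lborel (icell (mprod p ?k) (int (shift n))) (haar p n)
    = set_lebesgue_integral lborel (icell (mprod p ?k) (int (shift n)))
       (\<lambda>x. (\<lambda>t. complex_of_real (sqrt (real (mprod p ?k))) * unit_root (p (Suc ?k)) (int (freq n)) t)
            (digit p (Suc ?k) x))"
    unfolding set_lebesgue_integral_def
    by (intro Bochner_Integration.integral_cong) (auto simp: haar_eq[OF assms] split: split_indicator)
  also have "\<dots> = 0"
    by (subst set_integral_icell_digit[OF mprod_pos p_pos])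
       (simp add: sum_distrib_left[symmetric] sum_unit_root[OF nd p_pos])
  finally show ?thesis .
qed

text \<open>The support is an interval of level at least \<open>N\<close>, hence inside the given
  interval or disjoint from it; in the first case the previous cancellation applies. This is the
  one-variable source of the martingale property.\<close>

lemma set_integral_icell_haar:
  assumes "mprod p N \<le> n"
  shows "set_lebesgue_integral lborel (icell (mprod p N) c) (haar p n) = 0"
proof -
  let ?k = "haar_level p n"
  let ?J = "icell (mprod p ?k) (int (shift n))"
  have n: "n > 0" using assms mprod_pos[of N] by simp
  consider "?J \<subseteq> icell (mprod p N) c" | "?J \<inter> icell (mprod p N) c = {}"
    using icell_nested[OF haar_level_ge[OF assms]] by blast
  then show ?thesis
  proof cases
    case 1
    then have "set_lebesgue_integral lborel (icell (mprod p N) c) (haar p n)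
      = set_lebesgue_integral lborel ?J (haar p n)"
      unfolding set_lebesgue_integral_def haar_eq[OF n]
      by (intro Bochner_Integration.integral_cong) (auto simp: indicator_def)
    then show ?thesis using set_integral_support_haar[OF n] by simp
  next
    case 2
    then have "indicator (icell (mprod p N) c) x *\<^sub>R haar p n x = 0" for x
      by (auto simp: haar_eq[OF n] indicator_def)
    then show ?thesis unfolding set_lebesgue_integral_def by (simp only: Bochner_Integration.integral_zero)
  qed
qed

lemma icell_unit_subset:
  assumes "r < mprod p k"
  shows "icell (mprod p k) (int r) \<subseteq> icell 1 0"
proof
  fix x assume x: "x \<in> icell (mprod p k) (int r)"
  have "\<lfloor>x * real 1\<rfloor> = \<lfloor>x * real (mprod p k)\<rfloor> div int (mprod p k div 1)"
    by (rule floor_mult_eq_floor_div) (auto simp: mprod_pos)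
  then show "x \<in> icell 1 0" using x assms by (simp add: icell_def)
qed

text \<open>The function of lower index is constant on the support of the other one, so it comes out
  of an integral that vanishes.\<close>

lemma haar_orthogonal_lower:
  assumes "n > 0" "n' < mprod p (haar_level p n)"
  shows "set_lebesgue_integral lborel (icell 1 0) (\<lambda>x. haar p n x * cnj (haar p n' x)) = 0"
proof -
  let ?k = "haar_level p n"
  let ?J = "icell (mprod p ?k) (int (shift n))"
  have "?J \<noteq> {}" using mprod_pos[of ?k] by (simp add: icell_eq divide_less_cancel)
  then obtain y where y: "y \<in> ?J" by blast
  have "indicator (icell 1 0) x *\<^sub>R (haar p n x * cnj (haar p n' x))
      = (indicator ?J x *\<^sub>R haar p n x) * cnj (haar p n' y)" for x
  proof (cases "x \<in> ?J")
    case True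
    then have "haar p n' x = haar p n' y" using y assms(2) by (intro haar_const) (auto simp: icell_def)
    moreover have "x \<in> icell 1 0" using True icell_unit_subset[OF shift_less[OF assms(1)]] by blast
    ultimately show ?thesis using True by simp
  next
    case False
    then show ?thesis by (simp add: haar_eq[OF assms(1)])
  qed
  then show ?thesis
    using set_integral_support_haar[OF assms(1)]
    unfolding set_lebesgue_integral_def by (simp only: integral_mult_left_zero mult_zero_left)
qed

lemma haar_orthonormal:
  "set_lebesgue_integral lborel (icell 1 0) (\<lambda>x. haar p n x * cnj (haar p n' x)) = (if n = n' then 1 else 0)"
proof -
  have sym: "set_lebesgue_integral lborel (icell 1 0) (\<lambda>x. haar p n x * cnj (haar p n' x))
    = cnj (set_lebesgue_integral lborel (icell 1 0) (\<lambda>x. haar p n' x * cnj (haar p n x)))"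
    unfolding set_lebesgue_integral_def Bochner_Integration.integral_cnj[symmetric]
    by (simp add: mult.commute)
  \<comment> \<open>Up to symmetry, either both indices are 0, or one lies below the block of
    indices of the other's level, or both are positive and of the same level.\<close>
  consider "n = 0" "n' = 0" | "n > 0" "n' < mprod p (haar_level p n)"
    | "n' > 0" "n < mprod p (haar_level p n')"
    | "n > 0" "n' > 0" "haar_level p n = haar_level p n'"
  proof (cases "n = 0 \<or> n' = 0")
    case True
    then show ?thesis using that mprod_pos by (metis gr0I)
  next
    case False
    consider "haar_level p n < haar_level p n'" | "haar_level p n' < haar_level p n"
      | "haar_level p n = haar_level p n'" by linarith
    then show ?thesis
    proof cases
      case 1
      then have "mprod p (Suc (haar_level p n)) \<le> mprod p (haar_level p n')" by (intro mprod_mono) simp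
      then show ?thesis using haar_level_bounds(2)[of n] False that(3) by simp
    next
      case 2
      then have "mprod p (Suc (haar_level p n')) \<le> mprod p (haar_level p n)" by (intro mprod_mono) simp
      then show ?thesis using haar_level_bounds(2)[of n'] False that(2) by simp
    qed (use False that in auto)
  qed
  then show ?thesis
  proof cases
    case 1
    then show ?thesis
      using measure_icell[of 1 0] emeasure_icell[of 1 0] by (simp add: set_lebesgue_integral_def)
  next
    case 2
    then show ?thesis using haar_orthogonal_lower haar_level_bounds(1)[of n] by auto
  next
    case 3
    then show ?thesis using haar_orthogonal_lower[of n' n] haar_level_bounds(1)[of n'] sym by auto
  next
    case 4
    \<comment> \<open>Different shifts give disjoint supports. For equal shifts the product is a
      multiple of a character of the next digit, whose frequency is the difference of the two
      frequencies.\<close>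
    let ?k = "haar_level p n"
    let ?J = "icell (mprod p ?k) (int (shift n))" and ?q = "p (Suc ?k)"
    have J: "?J \<subseteq> icell 1 0" using icell_unit_subset[OF shift_less[OF 4(1)]] .
    show ?thesis
    proof (cases "shift n = shift n'")
      case False
      then have "haar p n x * cnj (haar p n' x) = 0" for x
        using 4 by (auto simp: haar_eq icell_def indicator_def)
      then show ?thesis
        using False unfolding set_lebesgue_integral_def
        by (simp only: scaleR_zero_right Bochner_Integration.integral_zero) auto
    next
      case True
      let ?u = "int (freq n) - int (freq n')"
      have pr: "indicator (icell 1 0) x *\<^sub>R (haar p n x * cnj (haar p n' x))
        = indicator ?J x *\<^sub>R (\<lambda>t. of_nat (mprod p ?k) * unit_root ?q ?u t) (digit p (Suc ?k) x)" for x
      proof (cases "x \<in> ?J")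
        case x: True
        have sq: "complex_of_real (sqrt (real (mprod p ?k))) * complex_of_real (sqrt (real (mprod p ?k)))
            = of_nat (mprod p ?k)"
          unfolding of_real_mult[symmetric] by simp
        have "haar p n x * cnj (haar p n' x) =
          (complex_of_real (sqrt (real (mprod p ?k))) * complex_of_real (sqrt (real (mprod p ?k)))) *
          (unit_root ?q (int (freq n)) (digit p (Suc ?k) x) * cnj (unit_root ?q (int (freq n')) (digit p (Suc ?k) x)))"
          using x 4(3) True by (simp add: haar_eq[OF 4(1)] haar_eq[OF 4(2)])
        then show ?thesis using x J unfolding unit_root_mult_cnj sq by auto
      qed (simp add: haar_eq[OF 4(1)])
      have "set_lebesgue_integral lborel (icell 1 0) (\<lambda>x. haar p n x * cnj (haar p n' x))
        = (\<Sum>t<?q. of_nat (mprod p ?k) * unit_root ?q ?u t) / of_nat (mprod p (Suc ?k))"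
        using set_integral_icell_digit[OF mprod_pos p_pos, of ?k "shift n"
            "\<lambda>t. of_nat (mprod p ?k) * unit_root ?q ?u t"]
        unfolding set_lebesgue_integral_def pr by simp
      also have "\<dots> = of_nat (mprod p ?k) * (\<Sum>t<?q. unit_root ?q ?u t) / of_nat (mprod p (Suc ?k))"
        by (simp add: sum_distrib_left)
      also have "\<dots> = (if n = n' then 1 else 0)"
      proof (cases "n = n'")
        case True
        then show ?thesis using mprod_pos[of ?k] p_pos[of ?k] by (simp add: mprod_Suc)
      next
        case False
        then have "freq n \<noteq> freq n'"
          using index_decomp[OF 4(1)] index_decomp[OF 4(2)] True 4(3) by metis
        then have "?u \<noteq> 0" "\<bar>?u\<bar> < int ?q" using freq_bounds[of n] freq_bounds[of n'] 4(3) by auto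
        then have "\<not> int ?q dvd ?u" using zdvd_not_zless[of "\<bar>?u\<bar>" "int ?q"] by auto
        then show ?thesis using sum_unit_root[OF _ p_pos] False by simp
      qed
      finally show ?thesis .
    qed
  qed
qed

end

subsection \<open>Cells in several variables\<close>

text \<open>Lebesgue measure on \<open>real^'n\<close> is an image of the product measure over
  \<open>Basis\<close>. As \<open>axis j 1\<close> enumerates \<open>Basis\<close>, a product over
  coordinates becomes one over basis vectors, and Fubini's theorem for products applies.\<close>

lemma
  fixes g :: "'n::finite \<Rightarrow> real \<Rightarrow> 'a::{real_normed_field,banach,second_countable_topology}"
  assumes g: "\<And>j. integrable lborel (g j)"
  shows integrable_lborel_cart_prod: "integrable lborel (\<lambda>x::real^'n. \<Prod>j\<in>UNIV. g j (x $ j))"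
    and integral_lborel_cart_prod:
      "integral\<^sup>L lborel (\<lambda>x::real^'n. \<Prod>j\<in>UNIV. g j (x $ j)) = (\<Prod>j\<in>UNIV. integral\<^sup>L lborel (g j))"
proof -
  \<comment> \<open>Inverse of the enumeration \<open>axis j 1\<close> of the basis, used to move
    products between the two index sets.\<close>
  define idx :: "real^'n \<Rightarrow> 'n" where "idx b = (THE j. b = axis j 1)" for b
  have idx: "idx (axis j 1) = j" for j
    unfolding idx_def by (rule the_equality) (auto simp: axis_eq_axis)
  let ?B = "Basis :: (real^'n) set"
  have bij: "bij_betw (\<lambda>j. axis j 1) UNIV ?B"
    unfolding bij_betw_def by (auto simp: inj_on_def axis_eq_axis Basis_vec_def)
  interpret product_sigma_finite "\<lambda>_::real^'n. lborel :: real measure" ..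
  let ?T = "\<lambda>f. \<Sum>b\<in>?B. f b *\<^sub>R b"
  have comp: "?T f $ j = f (axis j 1)" for f j
  proof -
    have "?T f $ j = (\<Sum>i\<in>UNIV. (f (axis i 1) *\<^sub>R (axis i 1 :: real^'n)) $ j)"
      by (simp add: sum.reindex_bij_betw[OF bij, symmetric])
    also have "\<dots> = (\<Sum>i\<in>UNIV. if i = j then f (axis i 1) else 0)"
      by (intro sum.cong) (auto simp: axis_def)
    finally show ?thesis by simp
  qed
  have prod_eq: "(\<Prod>j\<in>UNIV. g j (?T f $ j)) = (\<Prod>b\<in>?B. g (idx b) (f b))" for f
    unfolding comp by (simp add: prod.reindex_bij_betw[OF bij, symmetric] idx)
  have T: "?T \<in> (\<Pi>\<^sub>M b\<in>?B. lborel) \<rightarrow>\<^sub>M borel"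
    by measurable
  have "g j \<in> borel_measurable borel" for j
    using borel_measurable_integrable[OF g] by simp
  then have m: "(\<lambda>x::real^'n. \<Prod>j\<in>UNIV. g j (x $ j)) \<in> borel_measurable borel"
    by measurable
  have "integrable (\<Pi>\<^sub>M b\<in>?B. lborel) (\<lambda>f. \<Prod>b\<in>?B. g (idx b) (f b))"
    by (rule product_integrable_prod) (auto simp: g)
  then show "integrable lborel (\<lambda>x::real^'n. \<Prod>j\<in>UNIV. g j (x $ j))"
    by (subst lborel_eq, subst integrable_distr_eq[OF T m]) (simp only: prod_eq)
  have "integral\<^sup>L lborel (\<lambda>x::real^'n. \<Prod>j\<in>UNIV. g j (x $ j))
    = integral\<^sup>L (\<Pi>\<^sub>M b\<in>?B. lborel) (\<lambda>f. \<Prod>b\<in>?B. g (idx b) (f b))"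
    by (subst lborel_eq, subst integral_distr[OF T m]) (simp only: prod_eq)
  also have "\<dots> = (\<Prod>b\<in>?B. integral\<^sup>L lborel (g (idx b)))"
    by (rule product_integral_prod) (auto simp: g)
  also have "\<dots> = (\<Prod>j\<in>UNIV. integral\<^sup>L lborel (g j))"
    by (simp add: prod.reindex_bij_betw[OF bij, symmetric] idx)
  finally show "integral\<^sup>L lborel (\<lambda>x::real^'n. \<Prod>j\<in>UNIV. g j (x $ j)) = (\<Prod>j\<in>UNIV. integral\<^sup>L lborel (g j))" .
qed

text \<open>A cell is named by any of its points, so different points may name the same cell;
  families of cells are therefore indexed by the sets themselves. The unit cube without its upper
  faces is \<open>cell P 0 0\<close>.\<close>

definition cell :: "('n::finite \<Rightarrow> nat \<Rightarrow> nat) \<Rightarrow> nat \<Rightarrow> real^'n \<Rightarrow> (real^'n) set" where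
  "cell P N x = {y. \<forall>j. \<lfloor>y $ j * real (mprod (P j) N)\<rfloor> = \<lfloor>x $ j * real (mprod (P j) N)\<rfloor>}"

definition cell_vol :: "('n::finite \<Rightarrow> nat \<Rightarrow> nat) \<Rightarrow> nat \<Rightarrow> real" where
  "cell_vol P N = (\<Prod>j\<in>UNIV. 1 / real (mprod (P j) N))"

lemma cell_refl [simp]: "x \<in> cell P N x"
  by (simp add: cell_def)

lemma cell_eqI: "y \<in> cell P N x \<Longrightarrow> cell P N y = cell P N x"
  by (simp add: cell_def)

lemma indicator_cell:
  "(indicator (cell P N x) y :: 'a::comm_semiring_1) = (\<Prod>j\<in>UNIV. indicator (icell (mprod (P j) N) \<lfloor>x $ j * real (mprod (P j) N)\<rfloor>) (y $ j))"
proof (cases "y \<in> cell P N x")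
  case True
  then show ?thesis by (simp add: cell_def icell_def)
next
  case False
  then obtain j where "y $ j \<notin> icell (mprod (P j) N) \<lfloor>x $ j * real (mprod (P j) N)\<rfloor>"
    by (auto simp: cell_def icell_def)
  then have "(\<Prod>j\<in>UNIV. indicator (icell (mprod (P j) N) \<lfloor>x $ j * real (mprod (P j) N)\<rfloor>) (y $ j)) = (0::'a)"
    by (intro prod_zero) (auto intro!: exI[of _ j])
  then show ?thesis using False by simp
qed

lemma cell_borel [measurable]: "cell P N x \<in> sets borel"
proof -
  have "cell P N x = (\<Inter>j. (\<lambda>y. y $ j) -` icell (mprod (P j) N) \<lfloor>x $ j * real (mprod (P j) N)\<rfloor> \<inter> space borel)"
    by (auto simp: cell_def icell_def)
  moreover have "\<dots> \<in> sets borel"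
    by (intro sets.finite_INT measurable_sets[OF _ icell_sets]) auto
  ultimately show ?thesis by simp
qed

lemma cell_sets_lebesgue [measurable]: "cell P N x \<in> sets lebesgue"
  by simp

lemma unit_cell_iff: "x \<in> cell P 0 0 \<longleftrightarrow> (\<forall>j. 0 \<le> x $ j \<and> x $ j < 1)"
  by (simp add: cell_def floor_eq_iff)

section \<open>Auxiliary facts on measurability and integrals\<close>

lemma borel_measurable_cnj [measurable]:
  "f \<in> borel_measurable M \<Longrightarrow> (\<lambda>x. cnj (f x)) \<in> borel_measurable M"
  by (rule measurable_compose[of f M borel cnj borel]) (auto intro: borel_measurable_continuous_onI continuous_intros)

lemma integral_lebesgue_borel:
  fixes f :: "'a::euclidean_space \<Rightarrow> 'b::{banach, second_countable_topology}"
  assumes "f \<in> borel_measurable borel"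
  shows "integral\<^sup>L lebesgue f = integral\<^sup>L lborel f"
  using assms by (intro integral_completion) simp

lemma
  fixes f :: "'i \<Rightarrow> 'a \<Rightarrow> 'b::{banach, second_countable_topology}"
  assumes "\<And>i. i \<in> I \<Longrightarrow> set_integrable M A (f i)"
  shows set_integrable_sum: "set_integrable M A (\<lambda>x. \<Sum>i\<in>I. f i x)"
    and set_integral_sum: "set_lebesgue_integral M A (\<lambda>x. \<Sum>i\<in>I. f i x)
      = (\<Sum>i\<in>I. set_lebesgue_integral M A (f i))"
  using assms unfolding set_integrable_def set_lebesgue_integral_def scaleR_sum_right
  by (auto intro: Bochner_Integration.integrable_sum Bochner_Integration.integral_sum)

text \<open>The exceptional points lie on countably many hyperplanes, each of them a null
  set.\<close>

lemma AE_P_irrational: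
  fixes P :: "'n::finite \<Rightarrow> nat \<Rightarrow> nat"
  assumes "\<And>j k. mprod (P j) k > 0"
  shows "AE x in lebesgue. P_irrational P x"
proof -
  have "AE x :: real^'n in lebesgue. x $ j * real (mprod (P j) k) \<noteq> real_of_int c" for j k c
  proof -
    have "negligible {x :: real^'n. x $ j = real_of_int c / real (mprod (P j) k)}"
      unfolding cart_eq_inner_axis by (rule negligible_standard_hyperplane) simp
    then have "{x :: real^'n. x $ j = real_of_int c / real (mprod (P j) k)} \<in> null_sets lebesgue"
      by (simp add: negligible_iff_null_sets)
    from AE_not_in[OF this] show ?thesis
      by eventually_elim (use assms[of j k] in \<open>auto simp: field_simps\<close>)
  qed
  then have "AE x :: real^'n in lebesgue. \<forall>j k c. x $ j * real (mprod (P j) k) \<noteq> real_of_int c"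
    by (simp add: AE_all_countable)
  then show ?thesis
    by eventually_elim (auto simp: P_irrational_def Ints_def)
qed

lemma trunc_measurable [measurable]:
  assumes [measurable]: "g \<in> borel_measurable M" "l \<in> borel_measurable M"
  shows "(\<lambda>x. trunc (g x) (l x)) \<in> borel_measurable M"
  unfolding trunc_def by measurable

text \<open>Lets closed boxes, which overlap in faces, be exchanged with half-open cells inside
  integrals.\<close>

lemma set_integral_eq_AE:
  fixes f :: "'a \<Rightarrow> 'b::{banach, second_countable_topology}"
  assumes [measurable]: "f \<in> borel_measurable M" "A \<in> sets M" "B \<in> sets M"
    and "AE x in M. x \<in> A \<longleftrightarrow> x \<in> B"
  shows "set_lebesgue_integral M A f = set_lebesgue_integral M B f"
  unfolding set_lebesgue_integral_def
proof (rule integral_cong_AE)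
  show "AE x in M. indicat_real A x *\<^sub>R f x = indicat_real B x *\<^sub>R f x"
    using assms(4) by eventually_elim (simp add: indicator_def)
qed measurable

lemma norm_set_integral_diff_le:
  fixes u v :: "'a \<Rightarrow> complex"
  assumes u: "set_integrable M A u" and v: "set_integrable M A v"
    and A: "A \<in> sets M" and B: "B \<in> fmeasurable M"
    and in_B: "AE x in M. x \<in> A \<longrightarrow> norm (u x - v x) \<le> c"
    and off_B: "AE x in M. x \<in> A - B \<longrightarrow> u x = v x" and c: "0 \<le> c"
  shows "norm (set_lebesgue_integral M A u - set_lebesgue_integral M A v) \<le> c * measure M B"
proof -
  have "norm (set_lebesgue_integral M A u - set_lebesgue_integral M A v)
      = norm (LINT x|M. indicator A x *\<^sub>R (u x - v x))"
    using set_integral_diff(2)[OF u v] by (simp add: set_lebesgue_integral_def)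
  also have "\<dots> \<le> (LINT x|M. norm (indicator A x *\<^sub>R (u x - v x)))"
    by (rule integral_norm_bound)
  also have "\<dots> \<le> (LINT x|M. c * indicator B x)"
  proof (rule integral_mono_AE)
    show "integrable M (\<lambda>x. norm (indicat_real A x *\<^sub>R (u x - v x)))"
      using set_integral_diff(1)[OF u v] by (intro integrable_norm) (simp add: set_integrable_def)
    show "integrable M (\<lambda>x. c * indicat_real B x)"
      using B by (intro integrable_mult_right) (auto simp: fmeasurable_def integrable_indicator_iff)
    show "AE x in M. norm (indicat_real A x *\<^sub>R (u x - v x)) \<le> c * indicat_real B x"
      using in_B off_B by eventually_elim (use c in \<open>auto split: split_indicator\<close>)
  qed
  also have "\<dots> = c * measure M B" using B by (simp add: fmeasurableD)
  finally show ?thesis .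
qed

section \<open>Haar functions and partial sums in several variables\<close>

locale multi_radix =
  fixes P :: "'n::finite \<Rightarrow> nat \<Rightarrow> nat"
  assumes P_ge2: "\<And>j i. 1 \<le> i \<Longrightarrow> 2 \<le> P j i"
begin

sublocale R: radix "P j" for j
  by unfold_locales (rule P_ge2)

lemma cell_mono:
  assumes "k \<le> l" shows "cell P l x \<subseteq> cell P k x"
  unfolding cell_def by (intro subsetI CollectI allI R.floor_mprod_mono[OF assms]) simp

lemma cell_unit: "x \<in> cell P 0 0 \<Longrightarrow> cell P N x \<subseteq> cell P 0 0"
  using cell_mono[of 0 N x] cell_eqI[of x P 0 0] by simp

lemma cell_vol_pos: "cell_vol P N > 0"
  unfolding cell_vol_def using R.mprod_pos by (intro prod_pos) simp

lemma measure_cell [simp]: "measure lebesgue (cell P N x) = cell_vol P N"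
  and emeasure_cell: "emeasure lebesgue (cell P N x) = ennreal (cell_vol P N)"
  and cell_lmeasurable [intro]: "cell P N x \<in> lmeasurable"
proof -
  let ?J = "\<lambda>j. icell (mprod (P j) N) \<lfloor>x $ j * real (mprod (P j) N)\<rfloor>"
  have i: "integrable lborel (\<lambda>t. indicator (?J j) t :: real)" for j
    using emeasure_icell[OF R.mprod_pos] by (auto simp: integrable_indicator_iff)
  have e: "(indicator (cell P N x) :: _ \<Rightarrow> real) = (\<lambda>y. \<Prod>j\<in>UNIV. indicator (?J j) (y $ j))"
    by (auto simp: indicator_cell)
  have "integrable lborel (indicator (cell P N x) :: _ \<Rightarrow> real)"
    unfolding e by (rule integrable_lborel_cart_prod[OF i])
  then have fin: "emeasure lborel (cell P N x) < \<infinity>"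
    by (simp add: integrable_indicator_iff)
  have "measure lborel (cell P N x) = integral\<^sup>L lborel (indicator (cell P N x))"
    by simp
  also have "\<dots> = cell_vol P N"
    unfolding e by (subst integral_lborel_cart_prod[OF i]) (simp add: cell_vol_def measure_icell[OF R.mprod_pos])
  finally have m: "measure lborel (cell P N x) = cell_vol P N" .
  show m': "measure lebesgue (cell P N x) = cell_vol P N"
    using m by (simp add: measure_completion)
  show "cell P N x \<in> lmeasurable"
    using fin by (intro fmeasurableI) (auto simp: emeasure_completion)
  then show "emeasure lebesgue (cell P N x) = ennreal (cell_vol P N)"
    using m' by (simp add: emeasure_eq_measure2)
qed

lemma haar_multi_measurable [measurable]: "haar_multi P n \<in> borel_measurable borel"
  unfolding haar_multi_def by measurable

lemma haar_psum_measurable [measurable]: "haar_psum P a N \<in> borel_measurable borel"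
  unfolding haar_psum_def by measurable

lemma norm_haar_multi_le:
  "norm (haar_multi P n x) \<le> (\<Prod>j\<in>UNIV. sqrt (real (mprod (P j) (haar_level (P j) (n j)))))"
  unfolding haar_multi_def prod_norm[symmetric] by (intro prod_mono) (auto intro: R.norm_haar_le)

lemma norm_haar_multi_le_supnorm:
  assumes "x \<in> cbox 0 1" shows "norm (haar_multi P n x) \<le> haar_supnorm P n"
  unfolding haar_supnorm_def using assms norm_haar_multi_le
  by (intro cSUP_upper) (auto intro!: bdd_aboveI2)

lemma haar_multi_const:
  assumes "\<forall>j. n j < mprod (P j) N" "y \<in> cell P N x"
  shows "haar_multi P n y = haar_multi P n x"
  unfolding haar_multi_def using assms
  by (intro prod.cong refl R.haar_const) (auto simp: cell_def)

lemma haar_psum_const: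
  assumes "y \<in> cell P N x" shows "haar_psum P a N y = haar_psum P a N x"
  unfolding haar_psum_def using assms haar_multi_const by (intro sum.cong) auto

lemma integrable_bounded_cell:
  fixes f :: "real^'n \<Rightarrow> 'b::{banach, second_countable_topology}"
  assumes "f \<in> borel_measurable lebesgue" "\<And>y. y \<in> cell P N x \<Longrightarrow> norm (f y) \<le> B"
  shows "set_integrable lebesgue (cell P N x) f"
  unfolding set_integrable_def
proof (rule Bochner_Integration.integrable_bound[of _ "\<lambda>y. indicator (cell P N x) y * B"])
  show "integrable lebesgue (\<lambda>y. indicator (cell P N x) y * B)"
    using emeasure_cell by (intro integrable_mult_left) (auto simp: integrable_indicator_iff)
  show "(\<lambda>y. indicat_real (cell P N x) y *\<^sub>R f y) \<in> borel_measurable lebesgue"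
    using assms(1) by (intro borel_measurable_scaleR borel_measurable_indicator) auto
qed (auto simp: indicator_def assms(2) intro!: order_trans[OF assms(2)])

lemma set_integrable_cell_haar_multi: "set_integrable lebesgue (cell P N x) (haar_multi P n)"
  by (rule integrable_bounded_cell) (auto intro!: norm_haar_multi_le measurable_completion)

text \<open>The integral over a cell is a product of one-variable integrals over intervals, and a
  single index beyond level \<open>N\<close> already makes its factor vanish.\<close>

lemma set_integral_cell_haar_multi:
  assumes "mprod (P j) N \<le> n j"
  shows "set_lebesgue_integral lebesgue (cell P N x) (haar_multi P n) = 0"
proof -
  let ?J = "\<lambda>j. icell (mprod (P j) N) \<lfloor>x $ j * real (mprod (P j) N)\<rfloor>"
  let ?g = "\<lambda>j t. indicator (?J j) t *\<^sub>R haar (P j) (n j) t"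
  have i: "integrable lborel (?g j)" for j
  proof (rule Bochner_Integration.integrable_bound)
    show "integrable lborel (\<lambda>t. indicator (?J j) t * sqrt (real (mprod (P j) (haar_level (P j) (n j)))))"
      using emeasure_icell[OF R.mprod_pos] by (intro integrable_mult_left) (auto simp: integrable_indicator_iff)
    show "AE t in lborel. norm (?g j t) \<le> norm (indicator (?J j) t * sqrt (real (mprod (P j) (haar_level (P j) (n j)))))"
      using R.norm_haar_le by (intro AE_I2) (simp split: split_indicator)
  qed measurable
  have "indicator (cell P N x) y *\<^sub>R haar_multi P n y = (\<Prod>j\<in>UNIV. ?g j (y $ j))" for y
    unfolding haar_multi_def scaleR_conv_of_real prod.distrib indicator_cell of_real_prod ..
  then have "set_lebesgue_integral lebesgue (cell P N x) (haar_multi P n)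
     = integral\<^sup>L lebesgue (\<lambda>y::real^'n. \<Prod>j\<in>UNIV. ?g j (y $ j))"
    unfolding set_lebesgue_integral_def by presburger
  also have "\<dots> = integral\<^sup>L lborel (\<lambda>y::real^'n. \<Prod>j\<in>UNIV. ?g j (y $ j))"
    by (rule integral_lebesgue_borel) measurable
  also have "\<dots> = (\<Prod>j\<in>UNIV. integral\<^sup>L lborel (?g j))"
    by (rule integral_lborel_cart_prod[OF i])
  also have "\<dots> = 0"
    using R.set_integral_icell_haar[OF assms]
    by (intro prod_zero) (auto simp: set_lebesgue_integral_def intro!: exI[of _ j])
  finally show ?thesis .
qed

lemma haar_multi_orthonormal:
  "set_lebesgue_integral lebesgue (cell P 0 0) (\<lambda>x. haar_multi P n x * cnj (haar_multi P n' x)) = (if n = n' then 1 else 0)"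
proof -
  let ?g = "\<lambda>j t. indicator (icell 1 0) t *\<^sub>R (haar (P j) (n j) t * cnj (haar (P j) (n' j) t))"
  have i: "integrable lborel (?g j)" for j
  proof (rule Bochner_Integration.integrable_bound)
    let ?b = "\<lambda>n. sqrt (real (mprod (P j) (haar_level (P j) n)))"
    show "integrable lborel (\<lambda>t. indicator (icell 1 0) t * (?b (n j) * ?b (n' j)))"
      using emeasure_icell[of 1] by (intro integrable_mult_left) (auto simp: integrable_indicator_iff)
    have "norm (haar (P j) (n j) t * cnj (haar (P j) (n' j) t)) \<le> ?b (n j) * ?b (n' j)" for t
      unfolding norm_mult complex_mod_cnj by (intro mult_mono R.norm_haar_le) auto
    then show "AE t in lborel. norm (?g j t) \<le> norm (indicator (icell 1 0) t * (?b (n j) * ?b (n' j)))"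
      by (intro AE_I2) (simp split: split_indicator)
  qed measurable
  have "indicator (cell P 0 0) y *\<^sub>R (haar_multi P n y * cnj (haar_multi P n' y)) = (\<Prod>j\<in>UNIV. ?g j (y $ j))" for y
    unfolding haar_multi_def scaleR_conv_of_real prod.distrib indicator_cell of_real_prod by simp
  then have "set_lebesgue_integral lebesgue (cell P 0 0) (\<lambda>x. haar_multi P n x * cnj (haar_multi P n' x))
     = integral\<^sup>L lebesgue (\<lambda>y::real^'n. \<Prod>j\<in>UNIV. ?g j (y $ j))"
    unfolding set_lebesgue_integral_def by presburger
  also have "\<dots> = integral\<^sup>L lborel (\<lambda>y::real^'n. \<Prod>j\<in>UNIV. ?g j (y $ j))"
    by (rule integral_lebesgue_borel) measurable
  also have "\<dots> = (\<Prod>j\<in>UNIV. integral\<^sup>L lborel (?g j))"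
    by (rule integral_lborel_cart_prod[OF i])
  also have "\<dots> = (\<Prod>j\<in>UNIV. if n j = n' j then 1 else 0)"
    using R.haar_orthonormal by (simp add: set_lebesgue_integral_def)
  also have "\<dots> = (if n = n' then 1 else 0)"
    by (auto simp: fun_eq_iff)
  finally show ?thesis .
qed

lemma finite_index: "finite {n. \<forall>j. n j < mprod (P j) N}"
proof -
  have "{n. \<forall>j. n j < mprod (P j) N} = (\<Pi>\<^sub>E j\<in>UNIV. {..<mprod (P j) N})"
    by (auto simp: PiE_def)
  then show ?thesis by (simp add: finite_PiE)
qed

lemma index_mono: "N \<le> M \<Longrightarrow> {n. \<forall>j. n j < mprod (P j) N} \<subseteq> {n. \<forall>j. n j < mprod (P j) M}"
  using R.mprod_mono by (auto intro: less_le_trans)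

lemma set_integrable_cell_haar_psum: "set_integrable lebesgue (cell P N x) (haar_psum P a M)"
  unfolding haar_psum_def
  by (intro set_integrable_sum) (simp add: set_integrable_cell_haar_multi)

text \<open>This is the martingale property: terms whose index is beyond level \<open>N\<close> in
  some coordinate integrate to zero over the cell, and the remaining ones are constant on
  it.\<close>

lemma set_integral_cell_haar_psum:
  assumes "N \<le> M"
  shows "set_lebesgue_integral lebesgue (cell P N x) (haar_psum P a M)
    = of_real (cell_vol P N) * haar_psum P a N x"
proof -
  let ?I = "\<lambda>N. {n. \<forall>j. n j < mprod (P j) N}"
  have "set_lebesgue_integral lebesgue (cell P N x) (haar_psum P a M)
    = (\<Sum>n\<in>?I M. set_lebesgue_integral lebesgue (cell P N x) (\<lambda>x. a n * haar_multi P n x))"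
    unfolding haar_psum_def
    by (intro set_integral_sum) (simp add: set_integrable_cell_haar_multi)
  also have "\<dots> = (\<Sum>n\<in>?I N. set_lebesgue_integral lebesgue (cell P N x) (\<lambda>x. a n * haar_multi P n x))"
    by (intro sum.mono_neutral_right finite_index index_mono[OF assms])
       (auto simp: not_less set_integral_cell_haar_multi)
  also have "\<dots> = (\<Sum>n\<in>?I N. of_real (cell_vol P N) * (a n * haar_multi P n x))"
  proof (intro sum.cong refl)
    fix n assume n: "n \<in> ?I N"
    have "indicator (cell P N x) y *\<^sub>R (a n * haar_multi P n y)
       = indicator (cell P N x) y *\<^sub>R (a n * haar_multi P n x)" for y
      using haar_multi_const[of n N y x] n by (auto split: split_indicator)
    then have "set_lebesgue_integral lebesgue (cell P N x) (\<lambda>x. a n * haar_multi P n x)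
      = (LINT y|lebesgue. indicator (cell P N x) y *\<^sub>R (a n * haar_multi P n x))"
      unfolding set_lebesgue_integral_def by presburger
    also have "\<dots> = of_real (cell_vol P N) * (a n * haar_multi P n x)"
      using emeasure_cell[of N x]
      by (subst integral_scaleR_left) (auto simp: integrable_indicator_iff scaleR_conv_of_real)
    finally show "set_lebesgue_integral lebesgue (cell P N x) (\<lambda>x. a n * haar_multi P n x)
       = of_real (cell_vol P N) * (a n * haar_multi P n x)" .
  qed
  finally show ?thesis by (simp add: haar_psum_def sum_distrib_left)
qed

lemma haar_psum_coefficient:
  assumes "\<forall>j. n j < mprod (P j) N"
  shows "set_lebesgue_integral lebesgue (cell P 0 0) (\<lambda>x. haar_psum P a N x * cnj (haar_multi P n x)) = a n"
proof -
  let ?I = "{n. \<forall>j. n j < mprod (P j) N}"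
  have int: "set_integrable lebesgue (cell P 0 0) (\<lambda>x. haar_multi P n' x * cnj (haar_multi P n x))" for n'
  proof (rule integrable_bounded_cell)
    let ?b = "\<lambda>n. \<Prod>j\<in>UNIV. sqrt (real (mprod (P j) (haar_level (P j) (n j))))"
    show "norm (haar_multi P n' y * cnj (haar_multi P n y)) \<le> ?b n' * ?b n" for y
      unfolding norm_mult complex_mod_cnj by (intro mult_mono norm_haar_multi_le) (auto intro: prod_nonneg)
  qed (rule measurable_completion, measurable)
  have "set_lebesgue_integral lebesgue (cell P 0 0) (\<lambda>x. haar_psum P a N x * cnj (haar_multi P n x))
    = set_lebesgue_integral lebesgue (cell P 0 0) (\<lambda>x. \<Sum>n'\<in>?I. a n' * (haar_multi P n' x * cnj (haar_multi P n x)))"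
    unfolding haar_psum_def by (simp add: sum_distrib_right mult.assoc)
  also have "\<dots> = (\<Sum>n'\<in>?I. set_lebesgue_integral lebesgue (cell P 0 0) (\<lambda>x. a n' * (haar_multi P n' x * cnj (haar_multi P n x))))"
    using int by (intro set_integral_sum) simp
  also have "\<dots> = (\<Sum>n'\<in>?I. if n' = n then a n else 0)"
    by (intro sum.cong refl) (simp add: haar_multi_orthonormal)
  also have "\<dots> = a n" using assms by (simp add: finite_index)
  finally show ?thesis .
qed


subsection \<open>Stopping the martingale of partial sums\<close>

lemma finite_cells: "finite (cell P N ` cell P 0 0)"
proof -
  let ?key = "\<lambda>x j. \<lfloor>x $ j * real (mprod (P j) N)\<rfloor>"
  \<comment> \<open>A cell is determined by its vector of floors, and over the unit cell these
    vectors range in a finite box.\<close>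
  have "?key ` cell P 0 0 \<subseteq> (\<Pi>\<^sub>E j\<in>UNIV. {0..int (mprod (P j) N)})"
  proof safe
    fix x :: "real^'n" and j assume "x \<in> cell P 0 0"
    then have "0 \<le> x $ j" "x $ j \<le> 1" by (simp_all add: unit_cell_iff less_imp_le)
    then have "0 \<le> x $ j * real (mprod (P j) N)" "x $ j * real (mprod (P j) N) \<le> real (mprod (P j) N)"
      by (auto intro: mult_left_le_one_le)
    then show "?key x j \<in> {0..int (mprod (P j) N)}"
      by (simp add: floor_le_iff)
  qed auto
  then have "finite (?key ` cell P 0 0)"
    by (rule finite_subset) (simp add: finite_PiE)
  then have "finite ((\<lambda>k. {y. \<forall>j. ?key y j = k j}) ` ?key ` cell P 0 0)"
    by (rule finite_imageI)
  then show ?thesis by (simp add: image_image cell_def)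
qed

lemma disjoint_cells: "disjoint_family_on (\<lambda>J. J) (cell P N ` A)"
proof -
  have "cell P N x = cell P N y" if "z \<in> cell P N x" "z \<in> cell P N y" for x y z
    using that cell_eqI by metis
  then show ?thesis unfolding disjoint_family_on_def by blast
qed

text \<open>These sets form the finite algebra generated by the cells of level \<open>N\<close> in
  the unit cell: the events known at time \<open>N\<close> of the martingale.\<close>

definition saturated :: "nat \<Rightarrow> (real^'n) set \<Rightarrow> bool" where
  "saturated N A \<longleftrightarrow> A \<subseteq> cell P 0 0 \<and> (\<forall>x\<in>A. cell P N x \<subseteq> A)"

lemma saturated_eq_Union: "saturated N A \<Longrightarrow> A = \<Union>(cell P N ` A)"
  unfolding saturated_def using cell_refl by blast

lemma saturated_finite: "saturated N A \<Longrightarrow> finite (cell P N ` A)"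
  unfolding saturated_def by (meson finite_cells finite_subset image_mono)

lemma saturated_sets: "saturated N A \<Longrightarrow> A \<in> sets lebesgue"
  by (subst saturated_eq_Union, assumption) (intro sets.finite_Union saturated_finite, auto)

lemma saturated_mono: "saturated N A \<Longrightarrow> N \<le> M \<Longrightarrow> saturated M A"
  unfolding saturated_def using cell_mono by blast

lemma saturated_cell: "x \<in> cell P 0 0 \<Longrightarrow> L \<le> N \<Longrightarrow> saturated N (cell P L x)"
  unfolding saturated_def using cell_unit cell_mono cell_eqI by metis

lemma saturated_Diff: "saturated N A \<Longrightarrow> saturated N B \<Longrightarrow> saturated N (A - B)"
proof -
  assume A: "saturated N A" and B: "saturated N B"
  have "y \<notin> B" if "x \<in> A - B" "y \<in> cell P N x" for x y
    using that B cell_eqI[of y P N x] cell_refl[of x P N] unfolding saturated_def by blast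
  then show "saturated N (A - B)" using A unfolding saturated_def by blast
qed

lemma set_integral_saturated:
  fixes f :: "real^'n \<Rightarrow> 'b::{banach, second_countable_topology}"
  assumes "saturated N A" "\<And>x. x \<in> A \<Longrightarrow> set_integrable lebesgue (cell P N x) f"
  shows "set_lebesgue_integral lebesgue A f = (\<Sum>J\<in>cell P N ` A. set_lebesgue_integral lebesgue J f)"
proof -
  have "(LINT x:(\<Union>J\<in>cell P N ` A. J)|lebesgue. f x) = (\<Sum>J\<in>cell P N ` A. LINT x:J|lebesgue. f x)"
    using assms(2) by (intro set_integral_finite_Union saturated_finite[OF assms(1)] disjoint_cells) auto
  then show ?thesis using saturated_eq_Union[OF assms(1)] by simp
qed

text \<open>The martingale property tested on events of level \<open>N\<close>; below it is applied
  to the complement of a stopping set.\<close>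

lemma set_integral_saturated_haar_psum:
  assumes "saturated N A" "N \<le> M"
  shows "set_lebesgue_integral lebesgue A (haar_psum P a M) = set_lebesgue_integral lebesgue A (haar_psum P a N)"
  unfolding set_integral_saturated[OF assms(1) set_integrable_cell_haar_psum]
  using assms(2) by (intro sum.cong) (auto simp: set_integral_cell_haar_psum)

text \<open>The density bounds add up because a saturated set is a finite disjoint union of cells.
  Applied to the newly stopped cells of each level, this charges the stopped region to
  \<open>E\<close>, as a maximal inequality would.\<close>

lemma measure_saturated_density:
  assumes A: "saturated N A" and E: "E \<in> sets lebesgue"
    and dens: "\<And>x. x \<in> A \<Longrightarrow> \<gamma> * cell_vol P N \<le> measure lebesgue (E \<inter> cell P N x)"
  shows "\<gamma> * measure lebesgue A \<le> measure lebesgue (E \<inter> A)"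
proof -
  have fm: "E \<inter> cell P N x \<in> lmeasurable" for x
    using cell_lmeasurable[of N x] E by (intro fmeasurable_Int_fmeasurable[of _ _ E, unfolded Int_commute[of _ E]]) auto
  have "measure lebesgue (\<Union>J\<in>cell P N ` A. J) = (\<Sum>J\<in>cell P N ` A. measure lebesgue J)"
    by (intro measure_finite_Union saturated_finite[OF A] disjoint_cells) (auto simp: emeasure_cell)
  then have 1: "measure lebesgue A = (\<Sum>J\<in>cell P N ` A. measure lebesgue J)"
    using saturated_eq_Union[OF A] by simp
  have "measure lebesgue (\<Union>J\<in>cell P N ` A. E \<inter> J) = (\<Sum>J\<in>cell P N ` A. measure lebesgue (E \<inter> J))"
  proof (intro measure_finite_Union saturated_finite[OF A])
    show "disjoint_family_on ((\<inter>) E) (cell P N ` A)"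
      using disjoint_cells[of N A] unfolding disjoint_family_on_def by blast
    show "emeasure lebesgue (E \<inter> J) \<noteq> \<infinity>" if "J \<in> cell P N ` A" for J
      using that fm by (auto simp: emeasure_eq_measure2)
  qed (use E in auto)
  moreover have "(\<Union>J\<in>cell P N ` A. E \<inter> J) = E \<inter> A"
    using saturated_eq_Union[OF A] by blast
  ultimately have 2: "measure lebesgue (E \<inter> A) = (\<Sum>J\<in>cell P N ` A. measure lebesgue (E \<inter> J))"
    by simp
  show ?thesis
    unfolding 1 2 sum_distrib_left using dens by (intro sum_mono) auto
qed

text \<open>The third assumption on \<open>\<gamma>\<close> makes stopping harmless: a cell whose
  parent holds at most the proportion \<open>\<gamma>\<close> of \<open>E\<close> cannot be filled
  by \<open>E\<close>, and the points outside \<open>E\<close> bound the sum on the whole cell.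
  \<open>small\<close> starts this argument at level \<open>L\<close>. The stopped limit
  \<open>F\<close> keeps the integral, and \<open>T\<close> is the region where it may differ from
  \<open>f\<close>.\<close>

lemma stopped_limit:
  fixes f :: "real^'n \<Rightarrow> complex"
  assumes x0: "x0 \<in> cell P 0 0" and E: "E \<in> sets lebesgue"
    and \<gamma>: "0 < \<gamma>" "\<gamma> < 1" "\<And>N. \<gamma> * cell_vol P N < cell_vol P (Suc N)"
    and small: "measure lebesgue (E \<inter> cell P L x0) \<le> \<gamma> * cell_vol P L"
    and bd: "AE x in lebesgue. x \<in> cell P L x0 - E \<longrightarrow> (\<forall>N\<ge>L. norm (haar_psum P a N x) \<le> \<Lambda>)"
    and conv: "AE x in lebesgue. x \<in> cell P L x0 \<longrightarrow> (\<lambda>N. haar_psum P a N x) \<longlonglongrightarrow> f x"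
  obtains F T where "F \<in> borel_measurable lebesgue" "T \<in> sets lebesgue" "T \<subseteq> cell P L x0"
    "\<gamma> * measure lebesgue T \<le> measure lebesgue (E \<inter> cell P L x0)"
    "AE x in lebesgue. x \<in> cell P L x0 \<longrightarrow> norm (F x) \<le> \<Lambda>"
    "AE x in lebesgue. x \<in> cell P L x0 - T \<longrightarrow> F x = f x"
    "set_lebesgue_integral lebesgue (cell P L x0) F = set_lebesgue_integral lebesgue (cell P L x0) (haar_psum P a L)"
proof -
  let ?I = "cell P L x0"
  let ?S = "haar_psum P a"
  \<comment> \<open>One stops on \<open>D\<close>, so \<open>T N\<close> is where stopping has occurred by level \<open>N\<close>;
    \<open>F i\<close> is the stopped partial sum of level \<open>L + i\<close>.\<close>
  define D where "D N = {x. \<gamma> * cell_vol P N < measure lebesgue (E \<inter> cell P N x)}" for N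
  define T where "T N = {x\<in>?I. \<exists>l. L \<le> l \<and> l \<le> N \<and> x \<in> D l}" for N
  define F where "F = rec_nat (?S L) (\<lambda>i F x. if x \<in> T (L + i) then F x else ?S (Suc (L + i)) x)"
  have F0: "F 0 = ?S L" and FS: "F (Suc i) = (\<lambda>x. if x \<in> T (L + i) then F i x else ?S (Suc (L + i)) x)" for i
    unfolding F_def by simp_all
  have Ilm: "?I \<in> lmeasurable" by (rule cell_lmeasurable)
  have fmE: "E \<inter> A \<in> lmeasurable" if "A \<in> sets lebesgue" "A \<subseteq> ?I" for A
    using that E Ilm by (intro fmeasurableI2[OF Ilm]) auto
  have Isub: "cell P N x \<subseteq> ?I" if "x \<in> ?I" "L \<le> N" for x N
    using cell_mono[OF that(2)] cell_eqI[OF that(1)] by metis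
  \<comment> \<open>If the bound failed, it would fail on the whole cell, where the sum is constant;
    then \<open>bd\<close> would put almost every point of the cell into \<open>E\<close>, against
    the strict inequality.\<close>
  have bd_pre: "norm (?S N x) \<le> \<Lambda>" if x: "x \<in> ?I" and N: "L \<le> N"
    and lt: "measure lebesgue (E \<inter> cell P N x) < cell_vol P N" for N x
  proof (rule ccontr)
    assume neg: "\<not> ?thesis"
    have "AE y in lebesgue. y \<in> cell P N x \<longleftrightarrow> y \<in> E \<inter> cell P N x"
      using bd
    proof eventually_elim
      case (elim y)
      show ?case
      proof (rule ccontr)
        assume "\<not> ?thesis"
        then have y: "y \<in> cell P N x" "y \<notin> E" by auto
        then have "norm (?S N y) \<le> \<Lambda>" using elim N Isub[OF x N] by blast
        then show False using haar_psum_const[OF y(1)] neg by simp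
      qed
    qed
    then have "measure lebesgue (cell P N x) = measure lebesgue (E \<inter> cell P N x)"
      using E by (intro measure_eq_AE) auto
    then show False using lt by simp
  qed
  \<comment> \<open>Only the levels before \<open>N\<close> are required to be unstopped, so the
    bound still holds at the level where stopping happens. The parent cell controls the measure of
    \<open>E\<close> in the cell; at \<open>N = L\<close> the assumption \<open>small\<close> takes
    over.\<close>
  have bd_S: "norm (?S N x) \<le> \<Lambda>" if x: "x \<in> ?I" and N: "L \<le> N" and nD: "\<And>l. L \<le> l \<Longrightarrow> l < N \<Longrightarrow> x \<notin> D l" for N x
  proof (rule bd_pre[OF x N])
    show "measure lebesgue (E \<inter> cell P N x) < cell_vol P N"
    proof (cases "N = L")
      case True
      have "\<gamma> * cell_vol P L < cell_vol P L" using \<gamma>(2) cell_vol_pos[of L] by simp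
      then show ?thesis using small cell_eqI[OF x] True by simp
    next
      case False
      then obtain N' where N': "N = Suc N'" "L \<le> N'" using N by (cases N) auto
      have "measure lebesgue (E \<inter> cell P N x) \<le> measure lebesgue (E \<inter> cell P N' x)"
        using cell_mono[of N' N x] N' Isub[OF x N'(2)] E
        by (intro measure_mono_fmeasurable fmE) auto
      also have "\<dots> \<le> \<gamma> * cell_vol P N'" using nD[OF N'(2)] N' by (simp add: D_def)
      also have "\<dots> < cell_vol P N" using \<gamma>(3) N' by simp
      finally show ?thesis .
    qed
  qed
  have Dcell: "y \<in> D l" if "x \<in> D l" "y \<in> cell P N x" "l \<le> N" for x y l N
    using that cell_eqI[of y P l x] cell_mono[OF that(3), of x] by (auto simp: D_def)
  have T_sat: "saturated N (T N)" for N
    unfolding saturated_def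
  proof (intro conjI ballI subsetI)
    fix x assume "x \<in> T N" then show "x \<in> cell P 0 0" using cell_unit[OF x0] by (auto simp: T_def)
  next
    fix x y assume "x \<in> T N" "y \<in> cell P N x"
    then obtain l where "x \<in> ?I" "L \<le> l" "l \<le> N" "x \<in> D l" "y \<in> cell P N x" by (auto simp: T_def)
    then show "y \<in> T N" using Dcell Isub[of x N] by (auto simp: T_def intro!: exI[of _ l])
  qed
  have T_sets [measurable]: "T N \<in> sets lebesgue" for N using saturated_sets[OF T_sat] .
  have T_sub: "T N \<subseteq> ?I" for N by (auto simp: T_def)
  have T_mono: "T N \<subseteq> T M" if "N \<le> M" for N M using that by (auto simp: T_def)
  \<comment> \<open>Induction over levels: the newly stopped set is a union of cells of level
    \<open>Suc N\<close> in each of which the proportion of \<open>E\<close> exceeds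
    \<open>\<gamma>\<close>, and it is disjoint from what was stopped before.\<close>
  have T_meas: "\<gamma> * measure lebesgue (T N) \<le> measure lebesgue (E \<inter> T N)" for N
  proof (induction N)
    case 0
    show ?case
    proof (rule measure_saturated_density[OF T_sat E])
      fix x assume "x \<in> T 0"
      then have "x \<in> D 0" by (auto simp: T_def)
      then show "\<gamma> * cell_vol P 0 \<le> measure lebesgue (E \<inter> cell P 0 x)" by (simp add: D_def)
    qed
  next
    case (Suc N)
    let ?U = "T (Suc N) - T N"
    have U: "saturated (Suc N) ?U"
      by (intro saturated_Diff T_sat saturated_mono[OF T_sat[of N]]) simp
    have "\<gamma> * measure lebesgue ?U \<le> measure lebesgue (E \<inter> ?U)"
    proof (rule measure_saturated_density[OF U E])
      fix x assume "x \<in> ?U"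
      then have "x \<in> D (Suc N)" by (auto simp: T_def le_Suc_eq)
      then show "\<gamma> * cell_vol P (Suc N) \<le> measure lebesgue (E \<inter> cell P (Suc N) x)" by (simp add: D_def)
    qed
    moreover have "measure lebesgue (T (Suc N)) = measure lebesgue (T N) + measure lebesgue ?U"
    proof -
      have "T (Suc N) = T N \<union> ?U" using T_mono[of N "Suc N"] by auto
      then show ?thesis
        using fmeasurableI2[OF Ilm T_sub T_sets] measure_Un_AE[of "T N" ?U lebesgue] by fastforce
    qed
    moreover have "measure lebesgue (E \<inter> T (Suc N)) = measure lebesgue (E \<inter> T N) + measure lebesgue (E \<inter> ?U)"
    proof -
      have "E \<inter> T (Suc N) = (E \<inter> T N) \<union> (E \<inter> ?U)" using T_mono[of N "Suc N"] by auto
      moreover have "measure lebesgue ((E \<inter> T N) \<union> (E \<inter> ?U)) = measure lebesgue (E \<inter> T N) + measure lebesgue (E \<inter> ?U)"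
        using T_sub by (intro measure_Un_AE fmE) auto
      ultimately show ?thesis by simp
    qed
    ultimately show ?case using Suc by (simp add: algebra_simps)
  qed
  define T' where "T' = (\<Union>N. T N)"
  have T'_sets [measurable]: "T' \<in> sets lebesgue" and T'_sub: "T' \<subseteq> ?I"
    using T_sub by (auto simp: T'_def)
  have T'_meas: "\<gamma> * measure lebesgue T' \<le> measure lebesgue (E \<inter> ?I)"
  proof -
    have "(\<lambda>N. measure lebesgue (T N)) \<longlonglongrightarrow> measure lebesgue T'"
      unfolding T'_def
    proof (rule Lim_measure_incseq)
      show "incseq T" using T_mono by (auto simp: incseq_def)
      have "emeasure lebesgue (\<Union> (range T)) \<le> emeasure lebesgue ?I"
        using T_sub by (intro emeasure_mono) auto
      then show "emeasure lebesgue (\<Union> (range T)) \<noteq> \<infinity>" using emeasure_cell[of L x0] by (auto simp: top_unique)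
    qed auto
    then have "(\<lambda>N. \<gamma> * measure lebesgue (T N)) \<longlonglongrightarrow> \<gamma> * measure lebesgue T'"
      by (intro tendsto_intros)
    moreover have "\<gamma> * measure lebesgue (T N) \<le> measure lebesgue (E \<inter> ?I)" for N
    proof -
      have "measure lebesgue (E \<inter> T N) \<le> measure lebesgue (E \<inter> ?I)"
        using T_sub E by (intro measure_mono_fmeasurable fmE) auto
      then show ?thesis using T_meas[of N] by simp
    qed
    ultimately show ?thesis by (intro LIMSEQ_le_const2) auto
  qed
  have F_bd: "norm (F i x) \<le> \<Lambda>" if "x \<in> ?I" for i x
  proof (induction i)
    case 0
    then show ?case using bd_S[OF that, of L] by (simp add: F0)
  next
    case (Suc i)
    show ?case
    proof (cases "x \<in> T (L + i)")
      case True then show ?thesis using Suc by (simp add: FS)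
    next
      case False
      then have "norm (?S (Suc (L + i)) x) \<le> \<Lambda>"
        using that by (intro bd_S) (auto simp: T_def)
      then show ?thesis using False by (simp add: FS)
    qed
  qed
  have S_meas [measurable]: "?S N \<in> borel_measurable lebesgue" for N
    by (rule measurable_completion) measurable
  have F_meas [measurable]: "F i \<in> borel_measurable lebesgue" for i
    by (induction i) (simp_all add: F0 FS)
  \<comment> \<open>A point stopped at level \<open>l\<close> keeps the sum of level
    \<open>l\<close>, so \<open>F i\<close> still equals the partial sum when stopping happens no
    earlier than level \<open>L + i\<close>; hence the shift by one. At \<open>i = 0\<close> the
    equation holds for every \<open>x\<close>, whatever the truncated subtraction gives.\<close>
  have F_off: "F i x = ?S (L + i) x" if "x \<notin> T (L + i - 1)" for i x
    using that by (cases i) (simp_all add: F0 FS)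
  have F_int: "set_integrable lebesgue ?I (F i)" for i
    using F_bd by (intro integrable_bounded_cell) auto
  \<comment> \<open>Where stopping has occurred the increment is zero. The remaining set is
    saturated at level \<open>L + i\<close>, so the next difference of partial sums integrates to
    zero over it.\<close>
  have F_step: "set_lebesgue_integral lebesgue ?I (F (Suc i)) = set_lebesgue_integral lebesgue ?I (F i)" for i
  proof -
    let ?A = "?I - T (L + i)"
    have A: "saturated (L + i) ?A"
      by (intro saturated_Diff T_sat saturated_cell x0) simp
    have i1: "set_integrable lebesgue ?A (?S N)" for N
      using set_integrable_cell_haar_psum[of L x0 a N] by (rule set_integrable_subset) auto
    have "set_lebesgue_integral lebesgue ?I (F (Suc i)) - set_lebesgue_integral lebesgue ?I (F i)
      = set_lebesgue_integral lebesgue ?I (\<lambda>x. F (Suc i) x - F i x)"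
      using F_int by simp
    also have "\<dots> = set_lebesgue_integral lebesgue ?A (\<lambda>x. ?S (Suc (L + i)) x - ?S (L + i) x)"
      unfolding set_lebesgue_integral_def
    proof (rule Bochner_Integration.integral_cong[OF refl])
      fix x
      show "indicat_real ?I x *\<^sub>R (F (Suc i) x - F i x) =
        indicat_real ?A x *\<^sub>R (?S (Suc (L + i)) x - ?S (L + i) x)"
      proof (cases "x \<in> T (L + i)")
        case True
        then show ?thesis by (simp add: FS)
      next
        case False
        moreover have "x \<notin> T (L + i - 1)" using False T_mono[of "L + i - 1" "L + i"] by auto
        ultimately show ?thesis using F_off[of x i] by (simp add: FS split: split_indicator)
      qed
    qed
    also have "\<dots> = 0"
      using i1 set_integral_saturated_haar_psum[OF A, of "Suc (L + i)" a] by simp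
    finally show ?thesis by simp
  qed
  have F_integral: "set_lebesgue_integral lebesgue ?I (F i) = set_lebesgue_integral lebesgue ?I (?S L)" for i
    by (induction i) (simp_all add: F0 F_step)
  have F_const: "(\<lambda>i. F i x) \<longlonglongrightarrow> F k x" if "x \<in> T (L + k)" for k x
  proof -
    have "x \<in> T (L + (k + d))" for d
      using T_mono[of "L + k" "L + (k + d)"] that by auto
    then have "F (k + d) x = F k x" for d
      by (induction d) (simp_all add: FS)
    then have "F i x = F k x" if "k \<le> i" for i using le_Suc_ex[OF that] by auto
    then show ?thesis by (intro tendsto_eventually eventually_sequentiallyI[of k])
  qed
  have F_lim: "(\<lambda>i. F i x) \<longlonglongrightarrow> f x" if "x \<notin> T'" "(\<lambda>N. ?S N x) \<longlonglongrightarrow> f x" for x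
  proof -
    have "F i x = ?S (i + L) x" for i using F_off[of x i] that(1) by (simp add: T'_def add.commute)
    then show ?thesis using LIMSEQ_ignore_initial_segment[OF that(2), of L] by simp
  qed
  \<comment> \<open>The limit exists almost everywhere in the cell: on \<open>T'\<close> the
    sequence is eventually frozen, off \<open>T'\<close> it is a tail of the convergent partial
    sums.\<close>
  define G where "G x = lim (\<lambda>i. F i x)" for x
  have G_lim: "AE x in lebesgue. x \<in> ?I \<longrightarrow> (\<lambda>i. F i x) \<longlonglongrightarrow> G x"
    using conv
  proof eventually_elim
    case (elim x)
    show ?case
    proof
      assume x: "x \<in> ?I"
      show "(\<lambda>i. F i x) \<longlonglongrightarrow> G x"
      proof (cases "x \<in> T'")
        case True
        then obtain N where "x \<in> T N" by (auto simp: T'_def)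
        then have "x \<in> T (L + N)" using T_mono[of N "L + N"] by auto
        from F_const[OF this] show ?thesis unfolding G_def by (metis limI)
      next
        case False
        from F_lim[OF this] elim x show ?thesis unfolding G_def by (metis limI)
      qed
    qed
  qed
  have G_meas [measurable]: "G \<in> borel_measurable lebesgue"
    unfolding G_def[abs_def] by measurable
  have G_bd: "AE x in lebesgue. x \<in> ?I \<longrightarrow> norm (G x) \<le> \<Lambda>"
    using G_lim
  proof eventually_elim
    case (elim x)
    then show ?case using F_bd[of x] by (auto intro!: LIMSEQ_le_const2[OF tendsto_norm])
  qed
  have G_eq: "AE x in lebesgue. x \<in> ?I - T' \<longrightarrow> G x = f x"
    using G_lim conv
  proof eventually_elim
    case (elim x)
    then show ?case using F_lim[of x] LIMSEQ_unique by blast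
  qed
  \<comment> \<open>The uniform bound \<open>\<Lambda>\<close> on a set of finite measure permits
    dominated convergence, and the integrals on the left do not depend on \<open>i\<close>.\<close>
  have "(\<lambda>i. set_lebesgue_integral lebesgue ?I (F i)) \<longlonglongrightarrow> set_lebesgue_integral lebesgue ?I G"
    unfolding set_lebesgue_integral_def
  proof (rule integral_dominated_convergence)
    show "integrable lebesgue (\<lambda>x. indicator ?I x * \<Lambda>)"
      using emeasure_cell[of L x0] by (intro integrable_mult_left) (auto simp: integrable_indicator_iff)
    show "AE x in lebesgue. (\<lambda>i. indicat_real ?I x *\<^sub>R F i x) \<longlonglongrightarrow> indicat_real ?I x *\<^sub>R G x"
      using G_lim by eventually_elim (auto split: split_indicator)
    show "AE x in lebesgue. norm (indicat_real ?I x *\<^sub>R F i x) \<le> indicat_real ?I x * \<Lambda>" for i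
      using F_bd by (intro AE_I2) (auto split: split_indicator)
  qed measurable
  then have "set_lebesgue_integral lebesgue ?I G = set_lebesgue_integral lebesgue ?I (?S L)"
    unfolding F_integral by (simp add: LIMSEQ_const_iff)
  with that[OF G_meas T'_sets T'_sub T'_meas G_bd G_eq] show thesis by blast
qed


subsection \<open>The majorant at irrational points\<close>

lemma AE_irrational: "AE x in lebesgue. P_irrational P x"
  by (rule AE_P_irrational[OF R.mprod_pos])

text \<open>No grid hyperplane passes through an irrational point, so closed, half-open and open
  intervals agree there. The closed form serves membership in boxes, the open one membership in
  their interiors.\<close>

lemma P_irrational_floor:
  assumes "P_irrational P x"
  shows "real_of_int c / real (mprod (P j) k) \<le> x $ j \<and> x $ j \<le> (real_of_int c + 1) / real (mprod (P j) k)
    \<longleftrightarrow> \<lfloor>x $ j * real (mprod (P j) k)\<rfloor> = c"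
    "real_of_int c / real (mprod (P j) k) < x $ j \<and> x $ j < (real_of_int c + 1) / real (mprod (P j) k)
    \<longleftrightarrow> \<lfloor>x $ j * real (mprod (P j) k)\<rfloor> = c"
proof -
  have "x $ j * real (mprod (P j) k) \<noteq> real_of_int i" for i
    using assms unfolding P_irrational_def by (metis Ints_of_int)
  from this[of c] this[of "c + 1"]
  show "real_of_int c / real (mprod (P j) k) \<le> x $ j \<and> x $ j \<le> (real_of_int c + 1) / real (mprod (P j) k)
    \<longleftrightarrow> \<lfloor>x $ j * real (mprod (P j) k)\<rfloor> = c"
    "real_of_int c / real (mprod (P j) k) < x $ j \<and> x $ j < (real_of_int c + 1) / real (mprod (P j) k)
    \<longleftrightarrow> \<lfloor>x $ j * real (mprod (P j) k)\<rfloor> = c"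
    using R.mprod_pos[of j k] by (auto simp: floor_eq_iff field_simps)
qed

text \<open>This passes from the closed boxes of the statement to half-open cells. The third claim
  is what makes boxes with disjoint interiors disjoint at irrational points.\<close>

lemma Lambda_k_cell:
  assumes I: "I \<in> Lambda_k P k" and x: "x \<in> I" "P_irrational P x"
  shows "cell P k x \<subseteq> I" "AE y in lebesgue. y \<in> I \<longleftrightarrow> y \<in> cell P k x" "x \<in> interior I"
proof -
  from I obtain c :: "'n \<Rightarrow> int" where c: "I = cbox (\<chi> j. real_of_int (c j) / real (mprod (P j) k))
                        (\<chi> j. (real_of_int (c j) + 1) / real (mprod (P j) k))"
    unfolding Lambda_k_def by blast
  have irr: "y \<in> I \<longleftrightarrow> (\<forall>j. \<lfloor>y $ j * real (mprod (P j) k)\<rfloor> = c j)" if "P_irrational P y" for y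
    using P_irrational_floor(1)[OF that] unfolding c by (simp add: mem_box_cart)
  have cx: "c j = \<lfloor>x $ j * real (mprod (P j) k)\<rfloor>" for j using irr[OF x(2)] x(1) by simp
  show "cell P k x \<subseteq> I"
  proof
    fix y assume "y \<in> cell P k x"
    then have "\<lfloor>y $ j * real (mprod (P j) k)\<rfloor> = c j" for j by (simp add: cell_def cx)
    then show "y \<in> I"
      unfolding c mem_box_cart using R.mprod_pos[of _ k]
      by (auto simp: floor_eq_iff field_simps intro: less_imp_le)
  qed
  show "AE y in lebesgue. y \<in> I \<longleftrightarrow> y \<in> cell P k x"
    using AE_irrational by eventually_elim (simp add: irr cell_def cx)
  show "x \<in> interior I"
    using P_irrational_floor(2)[OF x(2)] cx unfolding c interior_cbox by (simp add: mem_box_cart)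
qed

lemma Lambda_k_sets: "I \<in> Lambda_k P k \<Longrightarrow> I \<in> sets borel"
  unfolding Lambda_k_def by auto

lemma Lambda_k_exists: "\<exists>I\<in>Lambda_k P k. x \<in> I"
proof -
  let ?c = "\<lambda>j. \<lfloor>x $ j * real (mprod (P j) k)\<rfloor>"
  have "x \<in> cbox (\<chi> j. real_of_int (?c j) / real (mprod (P j) k)) (\<chi> j. (real_of_int (?c j) + 1) / real (mprod (P j) k))"
    unfolding mem_box_cart
  proof
    fix j
    have "x $ j * real (mprod (P j) k) \<le> real_of_int (?c j) + 1" by linarith
    then show "(\<chi> j. real_of_int (?c j) / real (mprod (P j) k)) $ j \<le> x $ j \<and>
        x $ j \<le> (\<chi> j. (real_of_int (?c j) + 1) / real (mprod (P j) k)) $ j"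
      using R.mprod_pos[of j k] by (simp add: divide_le_eq le_divide_eq)
  qed
  moreover have "cbox (\<chi> j. real_of_int (?c j) / real (mprod (P j) k)) (\<chi> j. (real_of_int (?c j) + 1) / real (mprod (P j) k))
      \<in> Lambda_k P k"
    unfolding Lambda_k_def by (intro CollectI exI[of _ ?c]) simp
  ultimately show ?thesis by (rule bexI)
qed

lemma measure_Lambda_k:
  assumes "I \<in> Lambda_k P k" "x \<in> I" "P_irrational P x"
  shows "measure lebesgue I = cell_vol P k"
  using measure_eq_AE[OF Lambda_k_cell(2)[OF assms]] Lambda_k_sets[OF assms(1)] by simp

text \<open>For a box \<open>I\<close> of level \<open>N\<close> containing \<open>x\<close>, the
  integrals defining \<open>haar_Psi\<close> are constant from level \<open>N\<close> on, so
  \<open>haar_Psi P a I\<close> divided by the volume is the partial sum itself. Every partial sum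
  at \<open>x\<close> thus enters the supremum.\<close>

lemma norm_haar_psum_le_Psi_star:
  assumes "P_irrational P x"
  shows "ereal (norm (haar_psum P a N x)) \<le> haar_Psi_star P a x"
proof -
  obtain I where I: "I \<in> Lambda_k P N" "x \<in> I" using Lambda_k_exists by blast
  note Ix = I assms
  have "set_lebesgue_integral lebesgue I (haar_psum P a M) = of_real (cell_vol P N) * haar_psum P a N x" if "N \<le> M" for M
  proof -
    have "set_lebesgue_integral lebesgue I (haar_psum P a M) = set_lebesgue_integral lebesgue (cell P N x) (haar_psum P a M)"
      using Lambda_k_sets[OF I(1)] haar_psum_measurable
      by (intro set_integral_eq_AE Lambda_k_cell(2)[OF Ix]) (auto intro: measurable_completion)
    then show ?thesis using set_integral_cell_haar_psum[OF that] by simp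
  qed
  then have "(\<lambda>M. set_lebesgue_integral lebesgue I (haar_psum P a M)) \<longlonglongrightarrow> of_real (cell_vol P N) * haar_psum P a N x"
    by (intro tendsto_eventually eventually_sequentiallyI[of N])
  then have "haar_Psi P a I = of_real (cell_vol P N) * haar_psum P a N x"
    unfolding haar_Psi_def by (rule limI)
  then have "norm (haar_psum P a N x) = norm (haar_Psi P a I) / measure lebesgue I"
    using cell_vol_pos[of N] by (simp add: measure_Lambda_k[OF Ix] norm_mult)
  then show ?thesis
    using I assms unfolding haar_Psi_star_def Lambda_def by (auto intro!: SUP_upper2[of I])
qed

lemma P_irrational_unit_cell:
  assumes "P_irrational P x" shows "x \<in> cbox 0 1 \<longleftrightarrow> x \<in> cell P 0 0"
proof -
  \<comment> \<open>Irrationality at level 0 excludes integer coordinates, in particular the upper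
    faces of the cube.\<close>
  have "x $ j * real (mprod (P j) 0) \<notin> \<int>" for j using assms unfolding P_irrational_def by blast
  then have "x $ j \<noteq> 1" for j by (metis Ints_1 mprod_0 mult.right_neutral of_nat_1)
  then show ?thesis by (auto simp: mem_box_cart unit_cell_iff less_le)
qed

text \<open>The supremum runs over countably many boxes, so the set is a countable union of
  measurable ones. Points that are not irrational drop out, since there the majorant is set to 0 and
  \<open>h\<close> is nonnegative.\<close>

lemma sets_exceedance:
  assumes [measurable]: "h \<in> borel_measurable lebesgue" and h0: "\<And>x. x \<in> cbox 0 1 \<Longrightarrow> 0 \<le> h x"
  shows "{x \<in> cbox 0 1. ereal (h x) < haar_Psi_star P a x} \<in> sets lebesgue"
proof -
  let ?r = "\<lambda>I. norm (haar_Psi P a I) / measure lebesgue I"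
  have "countable (Lambda_k P k)" for k
    unfolding Lambda_k_def by (auto simp: full_SetCompr_eq)
  then have cnt: "countable (Lambda P)" unfolding Lambda_def by auto
  have sI: "I \<in> sets lebesgue" if "I \<in> Lambda P" for I
    using that Lambda_k_sets unfolding Lambda_def by auto
  have nirr: "{x. \<not> P_irrational P x} \<in> sets lebesgue"
    using AE_irrational by (auto simp: completion.AE_iff_null_sets)
  then have irr: "{x. P_irrational P x} \<in> sets lebesgue"
    using sets.compl_sets[OF nirr] by (simp add: Compl_eq_Diff_UNIV[symmetric] Collect_neg_eq[symmetric])
  have "{x \<in> cbox 0 1. ereal (h x) < haar_Psi_star P a x}
     = (\<Union>I\<in>Lambda P. {x. P_irrational P x} \<inter> cbox 0 1 \<inter> I \<inter> {x \<in> space lebesgue. h x < ?r I})"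
    using h0 by (auto simp: haar_Psi_star_def less_SUP_iff not_less[symmetric] split: if_splits)
  also have "\<dots> \<in> sets lebesgue"
  proof (rule sets.countable_UN''[OF cnt])
    fix I assume "I \<in> Lambda P"
    moreover have "{x \<in> space lebesgue. h x < ?r I} \<in> sets lebesgue"
      by measurable
    moreover have "cbox 0 1 \<in> sets (lebesgue :: (real^'n) measure)" by simp
    ultimately show "{x. P_irrational P x} \<inter> cbox 0 1 \<inter> I \<inter> {x \<in> space lebesgue. h x < ?r I} \<in> sets lebesgue"
      using irr sI by blast
  qed
  finally show ?thesis .
qed

subsection \<open>The error estimate\<close>

text \<open>Volumes are at most 1, so the product is below both factors. This bounds the loss in
  volume when a box of the partition is refined to level \<open>K\<close>.\<close>

lemma cell_vol_mult_le: "cell_vol P k * cell_vol P K \<le> cell_vol P (max k K)"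
proof -
  have "cell_vol P N \<le> 1" for N
    unfolding cell_vol_def using R.mprod_pos by (intro prod_le_1) (simp add: Suc_leI)
  then have "cell_vol P k * cell_vol P K \<le> cell_vol P k" "cell_vol P k * cell_vol P K \<le> cell_vol P K"
    using cell_vol_pos[of k] cell_vol_pos[of K] by (simp_all add: mult_left_le mult_left_le_one_le)
  then show ?thesis by (simp add: max_def)
qed

text \<open>A cell has at most \<open>B\<close> children in each coordinate direction. This yields
  one \<open>\<gamma>\<close> valid at all levels.\<close>

lemma cell_vol_Suc_ge:
  assumes "\<And>j i. 1 \<le> i \<Longrightarrow> P j i \<le> B"
  shows "cell_vol P N \<le> real B ^ CARD('n) * cell_vol P (Suc N)"
proof -
  have "cell_vol P N = (\<Prod>j\<in>UNIV. real (P j (Suc N))) * cell_vol P (Suc N)"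
    unfolding cell_vol_def prod.distrib[symmetric] using R.p_pos[of _ N] R.mprod_pos[of _ N]
    by (intro prod.cong) (auto simp: mprod_Suc)
  also have "(\<Prod>j\<in>UNIV. real (P j (Suc N))) \<le> (\<Prod>j\<in>(UNIV::'n set). real B)"
    using assms by (intro prod_mono) auto
  finally show ?thesis using cell_vol_pos[of "Suc N"] by simp
qed

text \<open>Here \<open>c\<close> stands for the conjugate of the constant value of the Haar
  function on the cell, and \<open>g\<close> for the truncated product. With \<open>F\<close> and
  \<open>T\<close> from \<open>stopped_limit\<close>, both \<open>c * F\<close> and \<open>g\<close>
  are almost everywhere bounded by \<open>M * \<Lambda>\<close> and agree outside \<open>T\<close>
  and \<open>E\<close>; the measure of \<open>T\<close> costs the factor
  \<open>1 / \<gamma>\<close>.\<close>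

lemma cell_estimate:
  fixes f g :: "real^'n \<Rightarrow> complex"
  assumes x0: "x0 \<in> cell P 0 0" and E: "E \<in> sets lebesgue"
    and \<gamma>: "0 < \<gamma>" "\<gamma> < 1" "\<And>N. \<gamma> * cell_vol P N < cell_vol P (Suc N)"
    and small: "measure lebesgue (E \<inter> cell P L x0) \<le> \<gamma> * cell_vol P L"
    and bd: "AE x in lebesgue. x \<in> cell P L x0 - E \<longrightarrow> (\<forall>N\<ge>L. norm (haar_psum P a N x) \<le> \<Lambda>)"
    and conv: "AE x in lebesgue. x \<in> cell P L x0 \<longrightarrow> (\<lambda>N. haar_psum P a N x) \<longlonglongrightarrow> f x"
    and g: "g \<in> borel_measurable lebesgue" "\<And>x. x \<in> cell P L x0 \<Longrightarrow> norm (g x) \<le> M * \<Lambda>"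
    and gf: "AE x in lebesgue. x \<in> cell P L x0 - E \<longrightarrow> g x = c * f x"
    and c: "norm c \<le> M" and \<Lambda>: "0 \<le> \<Lambda>"
  shows "norm (c * set_lebesgue_integral lebesgue (cell P L x0) (haar_psum P a L)
      - set_lebesgue_integral lebesgue (cell P L x0) g)
    \<le> 2 * M * (1 / \<gamma> + 1) * (\<Lambda> * measure lebesgue (E \<inter> cell P L x0))"
proof -
  let ?I = "cell P L x0"
  from stopped_limit[OF x0 E \<gamma> small bd conv] obtain F T where
    F: "F \<in> borel_measurable lebesgue" and T: "T \<in> sets lebesgue" "T \<subseteq> ?I"
    and T_meas: "\<gamma> * measure lebesgue T \<le> measure lebesgue (E \<inter> ?I)"
    and F_bd: "AE x in lebesgue. x \<in> ?I \<longrightarrow> norm (F x) \<le> \<Lambda>"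
    and Ff: "AE x in lebesgue. x \<in> ?I - T \<longrightarrow> F x = f x"
    and F_int: "set_lebesgue_integral lebesgue ?I F = set_lebesgue_integral lebesgue ?I (haar_psum P a L)"
    by blast
  have Ilm: "?I \<in> lmeasurable" by (rule cell_lmeasurable)
  have M: "0 \<le> M" using c norm_ge_zero order_trans by blast
  have cF: "AE x in lebesgue. x \<in> ?I \<longrightarrow> norm (c * F x) \<le> M * \<Lambda>"
    using F_bd by eventually_elim (auto simp: norm_mult intro: mult_mono c M)
  have F_si: "set_integrable lebesgue ?I (\<lambda>x. c * F x)"
    unfolding set_integrable_def
  proof (rule Bochner_Integration.integrable_bound)
    show "integrable lebesgue (\<lambda>x. indicator ?I x * (M * \<Lambda>))"
      using emeasure_cell[of L x0] by (intro integrable_mult_left) (auto simp: integrable_indicator_iff)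
    show "AE x in lebesgue. norm (indicat_real ?I x *\<^sub>R (c * F x)) \<le> norm (indicator ?I x * (M * \<Lambda>))"
      using cF by eventually_elim (auto split: split_indicator)
  qed (use F in measurable)
  have g_si: "set_integrable lebesgue ?I g" using integrable_bounded_cell[OF g] by blast
  have lm: "T \<in> lmeasurable" "E \<inter> ?I \<in> lmeasurable"
    using fmeasurableI2[OF Ilm T(2,1)] E by (auto intro!: fmeasurableI2[OF Ilm])
  have "norm (set_lebesgue_integral lebesgue ?I (\<lambda>x. c * F x) - set_lebesgue_integral lebesgue ?I g)
     \<le> (2 * M * \<Lambda>) * measure lebesgue (T \<union> (E \<inter> ?I))"
  proof (rule norm_set_integral_diff_le[OF F_si g_si])
    show "AE x in lebesgue. x \<in> ?I \<longrightarrow> norm (c * F x - g x) \<le> 2 * M * \<Lambda>"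
      using cF
    proof eventually_elim
      case (elim x)
      then show ?case using g(2)[of x] norm_triangle_ineq4[of "c * F x" "g x"] by auto
    qed
    show "AE x in lebesgue. x \<in> ?I - (T \<union> (E \<inter> ?I)) \<longrightarrow> c * F x = g x"
      using Ff gf by eventually_elim auto
    show "T \<union> (E \<inter> ?I) \<in> lmeasurable" using lm by (rule fmeasurable.Un)
  qed (use M \<Lambda> in auto)
  also have "\<dots> \<le> (2 * M * \<Lambda>) * ((1 / \<gamma> + 1) * measure lebesgue (E \<inter> ?I))"
  proof (rule mult_left_mono)
    have "measure lebesgue (T \<union> (E \<inter> ?I)) \<le> measure lebesgue T + measure lebesgue (E \<inter> ?I)"
      using lm by (intro measure_Un_le) auto
    also have "measure lebesgue T \<le> 1 / \<gamma> * measure lebesgue (E \<inter> ?I)"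
      using T_meas \<gamma>(1) by (simp add: field_simps)
    finally show "measure lebesgue (T \<union> (E \<inter> ?I)) \<le> (1 / \<gamma> + 1) * measure lebesgue (E \<inter> ?I)"
      by (simp add: algebra_simps)
  qed (use M \<Lambda> in simp)
  finally show ?thesis
    unfolding set_integral_mult_right F_int by (simp only: mult_ac)
qed


text \<open>\<open>cell_estimate\<close> is summed over a refinement of the given boxes to level at
  least \<open>K\<close>, with a bound \<open>\<Lambda>\<close> comparable to \<open>h\<close> on
  each cell. The assumption \<open>small\<close> is global, but since every box carries mass at
  least \<open>\<delta>\<close>, it makes the proportion of \<open>E\<close> small in every single
  cell.\<close>

lemma coefficient_estimate:
  fixes f :: "real^'n \<Rightarrow> complex" and h :: "real^'n \<Rightarrow> real" and I :: "'i \<Rightarrow> (real^'n) set"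
    and lev :: "'i \<Rightarrow> nat" and a :: "('n \<Rightarrow> nat) \<Rightarrow> complex" and n :: "'n \<Rightarrow> nat"
  defines "E \<equiv> {x \<in> cbox 0 1. ereal (h x) < haar_Psi_star P a x}"
    and "M \<equiv> haar_supnorm P n"
  assumes \<gamma>: "0 < \<gamma>" "\<gamma> < 1" "\<And>N. \<gamma> * cell_vol P N < cell_vol P (Suc N)"
    and f [measurable]: "f \<in> borel_measurable lebesgue"
    and conv: "AE x in lebesgue. x \<in> cbox 0 1 \<longrightarrow> (\<lambda>N. haar_psum P a N x) \<longlonglongrightarrow> f x"
    and h [measurable]: "h \<in> borel_measurable lebesgue" and h0: "\<And>x. x \<in> cbox 0 1 \<Longrightarrow> 0 \<le> h x"
    and n: "\<forall>j. n j < mprod (P j) K"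
    and A: "finite A" "\<And>k. k \<in> A \<Longrightarrow> I k \<in> Lambda_k P (lev k)"
      "\<And>k k'. k \<in> A \<Longrightarrow> k' \<in> A \<Longrightarrow> k \<noteq> k' \<Longrightarrow> interior (I k) \<inter> interior (I k') = {}"
      "(\<Union>k\<in>A. I k) = cbox 0 1"
    and comparable: "\<And>k x y. k \<in> A \<Longrightarrow> x \<in> I k \<Longrightarrow> y \<in> I k \<Longrightarrow> h x \<le> C * h y"
    and C: "0 < C" and \<delta>: "0 < \<delta>" "\<And>k. k \<in> A \<Longrightarrow> \<delta> \<le> set_lebesgue_integral lebesgue (I k) h"
    and small: "C\<^sup>2 * set_lebesgue_integral lebesgue E h \<le> \<gamma> * (\<delta> * cell_vol P K)"
  shows "norm (a n - set_lebesgue_integral lebesgue (cbox 0 1) (\<lambda>x. trunc (f x * cnj (haar_multi P n x)) (M * h x)))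
    \<le> 2 * M * (1 / \<gamma> + 1) * (C\<^sup>2 * set_lebesgue_integral lebesgue E h)"
proof -
  let ?X = "cell P 0 0" and ?S = "haar_psum P a"
  let ?g = "\<lambda>x. trunc (f x * cnj (haar_multi P n x)) (M * h x)"
  define L where "L k = max (lev k) K" for k
  \<comment> \<open>Cells are taken through irrational points only: a point on an upper face of a
    closed box would name a cell in the neighbouring box or outside the cube.\<close>
  define \<R> where "\<R> = (\<Union>k\<in>A. cell P (L k) ` {x \<in> I k. P_irrational P x})"
  have E [measurable]: "E \<in> sets lebesgue"
    unfolding E_def by (rule sets_exceedance[OF h h0])
  have M_ge: "norm (haar_multi P n x) \<le> M" if "x \<in> cbox 0 1" for x
    unfolding M_def by (rule norm_haar_multi_le_supnorm[OF that])
  have M0: "0 \<le> M" using M_ge[of 0] norm_ge_zero[of "haar_multi P n 0"] by (simp add: mem_box_cart del: norm_ge_zero)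
  have chi_meas [measurable]: "haar_multi P n \<in> borel_measurable lebesgue"
    by (rule measurable_completion) measurable
  have S_meas [measurable]: "?S N \<in> borel_measurable lebesgue" for N
    by (rule measurable_completion) measurable
  have cchi_meas [measurable]: "(\<lambda>x. cnj (haar_multi P n x)) \<in> borel_measurable lebesgue"
    by (rule borel_measurable_cnj[OF chi_meas])
  have Schi_meas: "(\<lambda>x. ?S N x * cnj (haar_multi P n x)) \<in> borel_measurable lebesgue" for N
    by (intro borel_measurable_times S_meas cchi_meas)
  have g_meas [measurable]: "?g \<in> borel_measurable lebesgue"
    by measurable
  have I_sub: "I k \<subseteq> cbox 0 1" if "k \<in> A" for k using A(4) that by blast
  have sub_I: "cell P (L k) x \<subseteq> I k" if "k \<in> A" "x \<in> I k" "P_irrational P x" for k x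
    using cell_mono[of "lev k" "L k" x] Lambda_k_cell(1)[OF A(2)[OF that(1)] that(2,3)] by (auto simp: L_def)
  have in_X: "x \<in> ?X" if "k \<in> A" "x \<in> I k" "P_irrational P x" for k x
    using P_irrational_unit_cell[OF that(3)] I_sub[OF that(1)] that(2) by blast
  have R_cases: thesis if "J \<in> \<R>"
    "\<And>k x. k \<in> A \<Longrightarrow> x \<in> I k \<Longrightarrow> P_irrational P x \<Longrightarrow> x \<in> ?X \<Longrightarrow> J = cell P (L k) x \<Longrightarrow> J \<subseteq> I k \<Longrightarrow> thesis" for J thesis
  proof -
    from that(1) obtain k x where "k \<in> A" "x \<in> I k" "P_irrational P x" "J = cell P (L k) x"
      by (auto simp: \<R>_def)
    then show thesis using in_X sub_I by (intro that(2)[of k x]) auto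
  qed
  have R_sets [measurable]: "J \<in> sets lebesgue" if "J \<in> \<R>" for J
    using that by (auto simp: \<R>_def)
  have R_fin: "finite \<R>"
  proof (rule finite_subset)
    show "\<R> \<subseteq> (\<Union>k\<in>A. cell P (L k) ` ?X)" unfolding \<R>_def using in_X by blast
  qed (use A(1) finite_cells in auto)
  \<comment> \<open>Of two meeting cells the finer lies in the coarser, so \<open>x'\<close> also
    belongs to \<open>I k\<close>. Being irrational, it is interior to both boxes, which forces
    \<open>k = k'\<close> and hence equal levels.\<close>
  have nested: "cell P (L k) x = cell P (L k') x'"
    if k: "k \<in> A" "x \<in> I k" "P_irrational P x" and k': "k' \<in> A" "x' \<in> I k'" "P_irrational P x'"
      and z: "z \<in> cell P (L k) x" "z \<in> cell P (L k') x'" and le: "L k \<le> L k'" for k k' x x' z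
  proof -
    have "x' \<in> cell P (L k') z" using cell_eqI[OF z(2)] by simp
    then have "x' \<in> cell P (L k) x" using cell_mono[OF le, of z] cell_eqI[OF z(1)] by auto
    then have "x' \<in> I k" using sub_I[OF k] by blast
    then have "x' \<in> interior (I k)" "x' \<in> interior (I k')"
      using Lambda_k_cell(3) A(2) k k' by auto
    then have "k = k'" using A(3)[OF k(1) k'(1)] by blast
    then show ?thesis using z cell_eqI by metis
  qed
  have R_disj: "disjoint_family_on (\<lambda>J. J) \<R>"
    unfolding disjoint_family_on_def
  proof (intro ballI impI)
    fix J J' assume J: "J \<in> \<R>" and J': "J' \<in> \<R>" and ne: "J \<noteq> J'"
    from J obtain k x where k: "k \<in> A" "x \<in> I k" "P_irrational P x" "J = cell P (L k) x" by (auto simp: \<R>_def)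
    from J' obtain k' x' where k': "k' \<in> A" "x' \<in> I k'" "P_irrational P x'" "J' = cell P (L k') x'" by (auto simp: \<R>_def)
    show "J \<inter> J' = {}"
    proof (rule ccontr)
      assume "J \<inter> J' \<noteq> {}"
      then obtain z where "z \<in> J" "z \<in> J'" by blast
      then show False
        using nested[OF k(1-3) k'(1-3), of z] nested[OF k'(1-3) k(1-3), of z] ne k(4) k'(4)
        by (cases "L k \<le> L k'") auto
    qed
  qed
  have R_cover: "AE x in lebesgue. x \<in> (\<Union>J\<in>\<R>. J) \<longleftrightarrow> x \<in> cbox 0 1"
    using AE_irrational
  proof eventually_elim
    case (elim x)
    show ?case
    proof
      assume "x \<in> (\<Union>J\<in>\<R>. J)"
      then obtain J where "J \<in> \<R>" "x \<in> J" by blast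
      then show "x \<in> cbox 0 1" using I_sub by (elim R_cases) auto
    next
      assume "x \<in> cbox 0 1"
      then obtain k where "k \<in> A" "x \<in> I k" using A(4) by blast
      then show "x \<in> (\<Union>J\<in>\<R>. J)" using elim unfolding \<R>_def by (auto intro!: bexI[of _ k] exI[of _ x])
    qed
  qed
  have UR [measurable]: "(\<Union>J\<in>\<R>. J) \<in> sets lebesgue" using R_fin R_sets by (intro sets.finite_UN) auto
  have sum_R: "(\<Sum>J\<in>\<R>. set_lebesgue_integral lebesgue J u) = set_lebesgue_integral lebesgue (cbox 0 1) u"
    if u: "u \<in> borel_measurable lebesgue" "\<And>J. J \<in> \<R> \<Longrightarrow> set_integrable lebesgue J u" for u :: "real^'n \<Rightarrow> 'b::euclidean_space"
  proof -
    have "(\<Sum>J\<in>\<R>. set_lebesgue_integral lebesgue J u) = set_lebesgue_integral lebesgue (\<Union>J\<in>\<R>. J) u"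
      using set_integral_finite_Union[OF R_fin R_disj u(2) R_sets] by simp
    also have "\<dots> = set_lebesgue_integral lebesgue (cbox 0 1) u"
      by (intro set_integral_eq_AE R_cover u UR) simp
    finally show ?thesis .
  qed
  have h_int: "set_integrable lebesgue J h" if "J \<in> \<R>" for J
    using that
  proof (rule R_cases)
    fix k x assume k: "k \<in> A" "x \<in> I k" "J = cell P (L k) x" "J \<subseteq> I k"
    show ?thesis unfolding k(3)
    proof (rule integrable_bounded_cell[OF h])
      fix y assume "y \<in> cell P (L k) x"
      then have "y \<in> I k" using k(3,4) by blast
      then have "0 \<le> h y" "h y \<le> C * h x" using I_sub[OF k(1)] h0 comparable[OF k(1) _ k(2)] by blast+
      then show "norm (h y) \<le> C * h x" by simp
    qed
  qed
  have Eh_int: "set_integrable lebesgue J (\<lambda>x. indicator E x * h x)" if "J \<in> \<R>" for J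
    using integrable_mult_indicator[OF E h_int[OF that, unfolded set_integrable_def]]
    by (simp add: set_integrable_def mult_ac)
  have sum_Eh: "(\<Sum>J\<in>\<R>. set_lebesgue_integral lebesgue J (\<lambda>x. indicator E x * h x)) = set_lebesgue_integral lebesgue E h"
  proof -
    have "(\<Sum>J\<in>\<R>. set_lebesgue_integral lebesgue J (\<lambda>x. indicator E x * h x))
       = set_lebesgue_integral lebesgue (cbox 0 1) (\<lambda>x. indicator E x * h x)"
      by (intro sum_R Eh_int) measurable
    also have "\<dots> = set_lebesgue_integral lebesgue E h"
      unfolding set_lebesgue_integral_def E_def
      by (intro Bochner_Integration.integral_cong) (auto split: split_indicator)
    finally show ?thesis .
  qed
  have Eh_nonneg: "0 \<le> set_lebesgue_integral lebesgue J (\<lambda>x. indicator E x * h x)" if "J \<in> \<R>" for J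
    unfolding set_lebesgue_integral_def
    using h0 by (intro Bochner_Integration.integral_nonneg) (auto simp: E_def split: split_indicator)
  \<comment> \<open>A single level that refines all cells of \<open>\<R>\<close> and is large enough
    to recover \<open>a n\<close>, so that one partial sum serves the whole decomposition.\<close>
  define N where "N = Max (insert K (L ` A))"
  have LN: "L k \<le> N" if "k \<in> A" for k unfolding N_def using A(1) that by (intro Max_ge) auto
  have KN: "K \<le> N" unfolding N_def using A(1) by (intro Max_ge) auto
  have chi_const: "haar_multi P n y = haar_multi P n x" if "y \<in> cell P (L k) x" for x y k
    using that cell_mono[of K "L k" x] by (intro haar_multi_const[OF n]) (auto simp: L_def)
  \<comment> \<open>On the cell the Haar function is a constant, and the martingale property brings
    \<open>?S N\<close> back to the level of the cell.\<close>
  have Schi_si: "set_integrable lebesgue J (\<lambda>x. ?S N x * cnj (haar_multi P n x))"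
    and Schi: "set_lebesgue_integral lebesgue J (\<lambda>x. ?S N x * cnj (haar_multi P n x))
      = cnj (haar_multi P n x) * set_lebesgue_integral lebesgue J (?S (L k))" if J: "J = cell P (L k) x" "k \<in> A" for J k x
  proof -
    have eq: "indicator J y *\<^sub>R (?S N y * cnj (haar_multi P n y)) = cnj (haar_multi P n x) * (indicator J y *\<^sub>R ?S N y)" for y
      using chi_const[of y k x] J(1) by (auto split: split_indicator)
    show "set_integrable lebesgue J (\<lambda>x. ?S N x * cnj (haar_multi P n x))"
      unfolding set_integrable_def eq
      using set_integrable_cell_haar_psum[of "L k" x a N] J(1)
      by (intro integrable_mult_right) (simp add: set_integrable_def)
    have "set_lebesgue_integral lebesgue J (\<lambda>x. ?S N x * cnj (haar_multi P n x))
      = cnj (haar_multi P n x) * set_lebesgue_integral lebesgue J (?S N)"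
      unfolding set_lebesgue_integral_def eq by (rule integral_mult_right_zero)
    also have "set_lebesgue_integral lebesgue J (?S N) = set_lebesgue_integral lebesgue J (?S (L k))"
      using set_integral_cell_haar_psum[OF LN[OF J(2)], of x a] set_integral_cell_haar_psum[OF order_refl, of "L k" x a]
      by (simp add: J(1))
    finally show "set_lebesgue_integral lebesgue J (\<lambda>x. ?S N x * cnj (haar_multi P n x))
      = cnj (haar_multi P n x) * set_lebesgue_integral lebesgue J (?S (L k))" .
  qed
  have a_eq: "a n = (\<Sum>J\<in>\<R>. set_lebesgue_integral lebesgue J (\<lambda>x. ?S N x * cnj (haar_multi P n x)))"
  proof -
    have nN: "\<forall>j. n j < mprod (P j) N" using n index_mono[OF KN] by blast
    have "a n = set_lebesgue_integral lebesgue ?X (\<lambda>x. ?S N x * cnj (haar_multi P n x))"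
      using haar_psum_coefficient[OF nN] by simp
    also have "\<dots> = set_lebesgue_integral lebesgue (cbox 0 1) (\<lambda>x. ?S N x * cnj (haar_multi P n x))"
    proof (rule set_integral_eq_AE)
      show "AE x in lebesgue. x \<in> ?X \<longleftrightarrow> x \<in> cbox 0 1"
        using AE_irrational by eventually_elim (simp add: P_irrational_unit_cell)
    qed (simp_all add: Schi_meas)
    also have "\<dots> = (\<Sum>J\<in>\<R>. set_lebesgue_integral lebesgue J (\<lambda>x. ?S N x * cnj (haar_multi P n x)))"
      by (rule sum_R[OF Schi_meas, symmetric]) (auto simp: \<R>_def intro: Schi_si)
    finally show ?thesis .
  qed
  have AE_bd: "AE y in lebesgue. y \<in> cbox 0 1 - E \<longrightarrow> (\<forall>N. norm (?S N y) \<le> h y)"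
    using AE_irrational
  proof eventually_elim
    case (elim y)
    show ?case
    proof (intro impI allI)
      fix N assume "y \<in> cbox 0 1 - E"
      then have "haar_Psi_star P a y \<le> ereal (h y)" by (auto simp: E_def not_less)
      with norm_haar_psum_le_Psi_star[OF elim] have "ereal (norm (?S N y)) \<le> ereal (h y)" by (rule order_trans)
      then show "norm (?S N y) \<le> h y" by simp
    qed
  qed
  \<comment> \<open>Almost everywhere off \<open>E\<close> all partial sums are bounded by
    \<open>h\<close>, hence so is their limit \<open>f\<close>, and the truncation at
    \<open>M * h x\<close> leaves the product unchanged.\<close>
  have AE_g: "AE y in lebesgue. y \<in> cbox 0 1 - E \<longrightarrow> ?g y = cnj (haar_multi P n y) * f y"
    using AE_bd conv
  proof eventually_elim
    case (elim y)
    show ?case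
    proof
      assume y: "y \<in> cbox 0 1 - E"
      then have "norm (f y) \<le> h y"
        using elim by (auto intro!: LIMSEQ_le_const2[OF tendsto_norm])
      then have "norm (f y * cnj (haar_multi P n y)) \<le> M * h y"
        unfolding norm_mult complex_mod_cnj using M_ge[of y] M0 y h0[of y]
        by (subst mult.commute) (intro mult_mono, auto)
      then show "?g y = cnj (haar_multi P n y) * f y" by (simp add: trunc_def mult.commute)
    qed
  qed
  have g_bd: "norm (?g y) \<le> M * h y" if "y \<in> cbox 0 1" for y
    using h0[OF that] M0 by (simp add: trunc_def)
  have est: "set_integrable lebesgue J ?g \<and>
    norm (set_lebesgue_integral lebesgue J (\<lambda>x. ?S N x * cnj (haar_multi P n x)) - set_lebesgue_integral lebesgue J ?g)
      \<le> 2 * M * (1 / \<gamma> + 1) * (C\<^sup>2 * set_lebesgue_integral lebesgue J (\<lambda>x. indicator E x * h x))"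
    if J: "J \<in> \<R>" for J
    using J
  proof (rule R_cases)
    fix k x assume k: "k \<in> A" "x \<in> I k" "P_irrational P x" "x \<in> ?X" and Jc: "J = cell P (L k) x" and JI: "J \<subseteq> I k"
    let ?c = "cnj (haar_multi P n x)"
    \<comment> \<open>Comparability used in both directions gives \<open>h y \<le> \<Lambda>\<close>
      and \<open>\<Lambda> \<le> C\<^sup>2 * h y\<close> for all \<open>y\<close> in the box; the
      square of \<open>C\<close> in the final constant comes from here.\<close>
    define \<Lambda> where "\<Lambda> = C * h x"
    have h_le: "h y \<le> \<Lambda>" if "y \<in> I k" for y
      unfolding \<Lambda>_def by (rule comparable[OF k(1) that k(2)])
    have h_ge: "\<Lambda> \<le> C\<^sup>2 * h y" if "y \<in> I k" for y
      using comparable[OF k(1,2) that] C by (simp add: \<Lambda>_def power2_eq_square mult.assoc)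
    have JX: "J \<subseteq> cbox 0 1" using JI I_sub[OF k(1)] by blast
    have \<Lambda>0: "0 \<le> \<Lambda>" using C h0[of x] k(2) I_sub[OF k(1)] by (auto simp: \<Lambda>_def)
    have EJ: "E \<inter> J \<in> lmeasurable"
      by (rule fmeasurableI2[OF cell_lmeasurable[of "L k" x]]) (use E Jc in auto)
    \<comment> \<open>The lower bound on the mass of the box is turned into a lower bound on
      \<open>\<Lambda>\<close> times volume, first for the box and then for the smaller
      cell.\<close>
    have "\<delta> \<le> \<Lambda> * cell_vol P (lev k)"
    proof -
      have Is: "I k \<in> sets lebesgue" using Lambda_k_sets[OF A(2)[OF k(1)]] by simp
      have "I k \<in> lmeasurable" using A(2)[OF k(1)] unfolding Lambda_k_def by auto
      then have i: "integrable lebesgue (\<lambda>y. indicator (I k) y * \<Lambda>)"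
        by (intro integrable_mult_left) (auto simp: fmeasurable_def integrable_indicator_iff)
      have "set_lebesgue_integral lebesgue (I k) h \<le> (LINT y|lebesgue. indicator (I k) y * \<Lambda>)"
        unfolding set_lebesgue_integral_def
      proof (rule integral_mono)
        show "integrable lebesgue (\<lambda>y. indicat_real (I k) y *\<^sub>R h y)"
        proof (rule Bochner_Integration.integrable_bound[OF i])
          show "AE y in lebesgue. norm (indicat_real (I k) y *\<^sub>R h y) \<le> norm (indicat_real (I k) y * \<Lambda>)"
            using h_le h0 I_sub[OF k(1)] \<Lambda>0 by (intro AE_I2) (auto split: split_indicator)
        qed (use Is in measurable)
      qed (use i h_le in \<open>auto split: split_indicator\<close>)
      also have "\<dots> = \<Lambda> * cell_vol P (lev k)"
        using measure_Lambda_k[OF A(2)[OF k(1)] k(2,3)] Is by simp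
      finally show ?thesis using \<delta>(2)[OF k(1)] by simp
    qed
    then have "\<delta> * cell_vol P K \<le> \<Lambda> * cell_vol P (lev k) * cell_vol P K"
      using cell_vol_pos[of K] by (intro mult_right_mono) auto
    also have "\<dots> \<le> \<Lambda> * cell_vol P (L k)"
      using cell_vol_mult_le[of "lev k" K] \<Lambda>0 by (simp add: L_def mult.assoc mult_left_mono)
    finally have \<delta>L: "\<delta> * cell_vol P K \<le> \<Lambda> * cell_vol P (L k)" .
    have "0 < \<Lambda> * cell_vol P (L k)" using \<delta>L \<delta>(1) cell_vol_pos[of K] by (meson less_le_trans mult_pos_pos)
    then have \<Lambda>_pos: "0 < \<Lambda>" using cell_vol_pos[of "L k"] by (simp add: zero_less_mult_iff)
    have EJ_le: "\<Lambda> * measure lebesgue (E \<inter> J) \<le> C\<^sup>2 * set_lebesgue_integral lebesgue J (\<lambda>x. indicator E x * h x)"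
    proof -
      have "\<Lambda> * measure lebesgue (E \<inter> J) = (LINT y|lebesgue. \<Lambda> * indicator (E \<inter> J) y)"
        using EJ by (simp add: fmeasurableD)
      also have "\<dots> \<le> (LINT y|lebesgue. C\<^sup>2 * (indicator J y *\<^sub>R (indicator E y * h y)))"
      proof (rule integral_mono)
        show "integrable lebesgue (\<lambda>y. \<Lambda> * indicat_real (E \<inter> J) y)"
          using EJ by (intro integrable_mult_right) (auto simp: fmeasurable_def integrable_indicator_iff)
        show "integrable lebesgue (\<lambda>y. C\<^sup>2 * (indicat_real J y *\<^sub>R (indicat_real E y * h y)))"
          using Eh_int[OF J] by (intro integrable_mult_right) (simp add: set_integrable_def)
      qed (use h_ge JI in \<open>auto split: split_indicator\<close>)
      finally show ?thesis by (simp add: set_lebesgue_integral_def)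
    qed
    have J_le: "set_lebesgue_integral lebesgue J (\<lambda>x. indicator E x * h x) \<le> set_lebesgue_integral lebesgue E h"
      unfolding sum_Eh[symmetric] using Eh_nonneg by (intro member_le_sum[OF J _ R_fin]) auto
    \<comment> \<open>The integral of \<open>h\<close> over the part of \<open>E\<close> in
      \<open>J\<close> is at most that over \<open>E\<close>, which \<open>small\<close> compares
      with \<open>\<delta> * cell_vol P K\<close> and so with
      \<open>\<Lambda> * cell_vol P (L k)\<close>. Afterwards \<open>\<Lambda>\<close> cancels,
      being positive.\<close>
    have "\<Lambda> * measure lebesgue (E \<inter> J) \<le> \<Lambda> * (\<gamma> * cell_vol P (L k))"
    proof -
      have "\<Lambda> * measure lebesgue (E \<inter> J) \<le> C\<^sup>2 * set_lebesgue_integral lebesgue E h"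
        using EJ_le mult_left_mono[OF J_le, of "C\<^sup>2"] by simp
      also have "\<dots> \<le> \<gamma> * (\<Lambda> * cell_vol P (L k))"
        using order_trans[OF small mult_left_mono[OF \<delta>L less_imp_le[OF \<gamma>(1)]]] .
      finally show ?thesis by (simp add: mult_ac)
    qed
    then have small': "measure lebesgue (E \<inter> cell P (L k) x) \<le> \<gamma> * cell_vol P (L k)"
      using \<Lambda>_pos Jc by simp
    have norm_g: "norm (?g y) \<le> M * \<Lambda>" if "y \<in> cell P (L k) x" for y
      using that g_bd[of y] h_le[of y] JX JI M0 Jc by (meson mult_left_mono order_trans subsetD)
    have "norm (?c * set_lebesgue_integral lebesgue (cell P (L k) x) (?S (L k)) - set_lebesgue_integral lebesgue (cell P (L k) x) ?g)
      \<le> 2 * M * (1 / \<gamma> + 1) * (\<Lambda> * measure lebesgue (E \<inter> cell P (L k) x))"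
    proof (rule cell_estimate[OF k(4) E \<gamma> small' _ _ g_meas norm_g _ _ \<Lambda>0, where f = f])
      show "AE y in lebesgue. y \<in> cell P (L k) x - E \<longrightarrow> (\<forall>N\<ge>L k. norm (?S N y) \<le> \<Lambda>)"
        using AE_bd
      proof eventually_elim
        case (elim y)
        then show ?case using h_le[of y] JI JX Jc by (meson DiffD1 DiffD2 DiffI order_trans subsetD)
      qed
      show "AE y in lebesgue. y \<in> cell P (L k) x \<longrightarrow> (\<lambda>N. ?S N y) \<longlonglongrightarrow> f y"
        using conv by eventually_elim (use JX Jc in auto)
      show "AE y in lebesgue. y \<in> cell P (L k) x - E \<longrightarrow> ?g y = ?c * f y"
        using AE_g
      proof eventually_elim
        case (elim y)
        then show ?case using chi_const[of y k x] JX Jc by (metis DiffD1 DiffD2 DiffI subsetD)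
      qed
      show "norm ?c \<le> M" using M_ge[of x] I_sub[OF k(1)] k(2) by auto
    qed
    also have "\<dots> \<le> 2 * M * (1 / \<gamma> + 1) * (C\<^sup>2 * set_lebesgue_integral lebesgue J (\<lambda>x. indicator E x * h x))"
      using EJ_le M0 \<gamma>(1) Jc by (intro mult_left_mono) auto
    finally show ?thesis
      using integrable_bounded_cell[OF g_meas norm_g] Schi[OF Jc k(1)] Jc by simp
  qed
  have "a n - set_lebesgue_integral lebesgue (cbox 0 1) ?g
    = (\<Sum>J\<in>\<R>. set_lebesgue_integral lebesgue J (\<lambda>x. ?S N x * cnj (haar_multi P n x)) - set_lebesgue_integral lebesgue J ?g)"
    unfolding a_eq sum_subtractf using sum_R[OF g_meas] est by simp
  also have "norm \<dots> \<le> (\<Sum>J\<in>\<R>. 2 * M * (1 / \<gamma> + 1) * (C\<^sup>2 * set_lebesgue_integral lebesgue J (\<lambda>x. indicator E x * h x)))"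
    using est by (intro sum_norm_le) blast
  also have "\<dots> = 2 * M * (1 / \<gamma> + 1) * (C\<^sup>2 * set_lebesgue_integral lebesgue E h)"
    unfolding sum_Eh[symmetric] by (simp add: sum_distrib_left)
  finally show ?thesis .
qed

end

section \<open>Passage to the limit in \<open>m\<close>\<close>

theorem theorem5:
  fixes P :: "'n::finite \<Rightarrow> nat \<Rightarrow> nat"
    and a :: "('n \<Rightarrow> nat) \<Rightarrow> complex"
    and f :: "real^'n \<Rightarrow> complex"
    and h :: "nat \<Rightarrow> real^'n \<Rightarrow> real"
  assumes P_ge2: "\<forall>j i. 1 \<le> i \<longrightarrow> 2 \<le> P j i"
    and P_bdd: "\<exists>B. \<forall>j i. 1 \<le> i \<longrightarrow> P j i \<le> B"
    and conv: "AE x in lebesgue. x \<in> cbox 0 1 \<longrightarrow> (\<lambda>N. haar_psum P a N x) \<longlonglongrightarrow> f x"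
    and h_meas: "\<forall>m. h m \<in> borel_measurable (lebesgue_on (cbox 0 1))"
    and h_mono: "\<forall>m. \<forall>x\<in>cbox 0 1. 0 \<le> h m x \<and> h m x \<le> h (Suc m) x"
    and h_lim: "\<forall>x\<in>cbox 0 1. filterlim (\<lambda>m. h m x) at_top sequentially"
    and h_part: "\<exists>C>0. \<exists>(nn :: nat \<Rightarrow> nat) (I :: nat \<Rightarrow> nat \<Rightarrow> (real^'n) set).
        (\<forall>m.
          (\<forall>k\<in>{1..nn m}. I m k \<in> Lambda P) \<and>
          (\<forall>k\<in>{1..nn m}. \<forall>k'\<in>{1..nn m}. k \<noteq> k' \<longrightarrow> interior (I m k) \<inter> interior (I m k') = {}) \<and>
          (\<Union>k\<in>{1..nn m}. I m k) = cbox 0 1 \<and>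
          (\<forall>k\<in>{1..nn m}. \<forall>x\<in>I m k. \<forall>y\<in>I m k. h m x \<le> C * h m y)) \<and>
        (\<exists>\<delta>>0. \<forall>m. \<forall>k\<in>{1..nn m}. \<delta> \<le> set_lebesgue_integral lebesgue (I m k) (h m))"
    and Psi_cond: "(\<lambda>m. set_lebesgue_integral lebesgue
                     {x \<in> cbox 0 1. ereal (h m x) < haar_Psi_star P a x} (h m)) \<longlonglongrightarrow> 0"
  shows "\<forall>n. (\<lambda>m. set_lebesgue_integral lebesgue (cbox 0 1)
              (\<lambda>x. trunc (f x * cnj (haar_multi P n x)) (haar_supnorm P n * h m x))) \<longlonglongrightarrow> a n"
proof
  fix n :: "'n \<Rightarrow> nat"
  let ?X = "cbox 0 1 :: (real^'n) set"
  interpret multi_radix P by unfold_locales (use P_ge2 in blast)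
  obtain B where B: "\<And>j i. 1 \<le> i \<Longrightarrow> P j i \<le> B" using P_bdd by blast
  then have B2: "2 \<le> B" using P_ge2 order_trans by blast
  define b where "b = real B ^ CARD('n)"
  \<comment> \<open>\<open>b\<close> bounds the number of children of a cell; half its reciprocal
    leaves room for the strict inequality \<open>\<gamma>_vol\<close>.\<close>
  define \<gamma> where "\<gamma> = 1 / (2 * b)"
  have "1 \<le> b" unfolding b_def using B2 by (intro one_le_power) simp
  then have \<gamma>: "0 < \<gamma>" "\<gamma> < 1" "\<gamma> * b = 1 / 2" by (simp_all add: \<gamma>_def)
  have \<gamma>_vol: "\<gamma> * cell_vol P N < cell_vol P (Suc N)" for N
  proof -
    have "\<gamma> * cell_vol P N \<le> \<gamma> * (b * cell_vol P (Suc N))"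
      unfolding b_def using cell_vol_Suc_ge[OF B, of N] \<gamma>(1) by (intro mult_left_mono) auto
    also have "\<dots> < cell_vol P (Suc N)"
      using \<gamma>(3) cell_vol_pos[of "Suc N"] by (simp add: mult.assoc[symmetric])
    finally show ?thesis .
  qed
  have S_meas: "haar_psum P a N \<in> borel_measurable lebesgue" for N
    by (rule measurable_completion) measurable
  \<comment> \<open>Convergence to \<open>f\<close> is known only on the cube. The extension by zero
    is measurable because it agrees almost everywhere with a limit of partial sums, cut off outside
    the cube.\<close>
  define f' where "f' x = (if x \<in> ?X then f x else 0)" for x
  have f'_meas: "f' \<in> borel_measurable lebesgue"
  proof (rule borel_measurable_AE)
    show "(\<lambda>x. if x \<in> ?X then lim (\<lambda>N. haar_psum P a N x) else 0) \<in> borel_measurable lebesgue"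
      by (intro measurable_If_set borel_measurable_lim_metric S_meas) auto
    show "AE x in lebesgue. (if x \<in> ?X then lim (\<lambda>N. haar_psum P a N x) else 0) = f' x"
      using conv by eventually_elim (auto simp: f'_def limI)
  qed
  have conv': "AE x in lebesgue. x \<in> ?X \<longrightarrow> (\<lambda>N. haar_psum P a N x) \<longlonglongrightarrow> f' x"
    using conv by eventually_elim (simp add: f'_def)
  \<comment> \<open>\<open>h m\<close> is measurable and nonnegative only on the cube, so it too is
    extended by zero; the integrals over subsets of the cube stay the same.\<close>
  define h' where "h' m x = (if x \<in> ?X then h m x else 0)" for m x
  have h'_meas: "h' m \<in> borel_measurable lebesgue" for m
    unfolding h'_def[abs_def] using h_meas by (subst borel_measurable_if) auto
  have h'0: "0 \<le> h' m x" for m x using h_mono by (simp add: h'_def)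
  define E where "E m = {x \<in> ?X. ereal (h' m x) < haar_Psi_star P a x}" for m
  define \<epsilon> where "\<epsilon> m = set_lebesgue_integral lebesgue (E m) (h' m)" for m
  have "\<epsilon> = (\<lambda>m. set_lebesgue_integral lebesgue {x \<in> ?X. ereal (h m x) < haar_Psi_star P a x} (h m))"
  proof
    fix m
    have "E m = {x \<in> ?X. ereal (h m x) < haar_Psi_star P a x}" by (auto simp: E_def h'_def)
    then show "\<epsilon> m = set_lebesgue_integral lebesgue {x \<in> ?X. ereal (h m x) < haar_Psi_star P a x} (h m)"
      unfolding \<epsilon>_def set_lebesgue_integral_def
      by (intro Bochner_Integration.integral_cong) (auto simp: h'_def split: split_indicator)
  qed
  then have \<epsilon>_lim: "\<epsilon> \<longlonglongrightarrow> 0" using Psi_cond by simp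
  define part where "part C nn I \<longleftrightarrow> (\<forall>m. (\<forall>k\<in>{1..nn m}. I m k \<in> Lambda P) \<and>
          (\<forall>k\<in>{1..nn m}. \<forall>k'\<in>{1..nn m}. k \<noteq> k' \<longrightarrow> interior (I m k) \<inter> interior (I m k') = {}) \<and>
          (\<Union>k\<in>{1..nn m}. I m k) = ?X \<and>
          (\<forall>k\<in>{1..nn m}. \<forall>x\<in>I m k. \<forall>y\<in>I m k. h m x \<le> C * h m y))"
    for C and nn :: "nat \<Rightarrow> nat" and I :: "nat \<Rightarrow> nat \<Rightarrow> (real^'n) set"
  define mass where "mass \<delta> nn I \<longleftrightarrow> (\<forall>m. \<forall>k\<in>{1..nn m}. \<delta> \<le> set_lebesgue_integral lebesgue (I m k) (h m))"
    for \<delta> and nn :: "nat \<Rightarrow> nat" and I :: "nat \<Rightarrow> nat \<Rightarrow> (real^'n) set"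
  have "\<exists>C>0. \<exists>nn I. part C nn I \<and> (\<exists>\<delta>>0. mass \<delta> nn I)"
    unfolding part_def mass_def by (rule h_part)
  then obtain C \<delta> nn I where C: "0 < C" and \<delta>: "0 < \<delta>" and part: "part C nn I" and mass: "mass \<delta> nn I"
    by blast
  note parts = part[unfolded part_def, THEN spec]
  note I_Lambda = parts[THEN conjunct1, rule_format]
    and I_disj = parts[THEN conjunct2, THEN conjunct1, rule_format]
    and I_Un = parts[THEN conjunct2, THEN conjunct2, THEN conjunct1]
    and I_comp = parts[THEN conjunct2, THEN conjunct2, THEN conjunct2, rule_format]
    and I_mass = mass[unfolded mass_def, rule_format]
  have I_sub: "I m k \<subseteq> ?X" if "k \<in> {1..nn m}" for m k using I_Un[of m] that by blast
  have "\<forall>m k. \<exists>l. k \<in> {1..nn m} \<longrightarrow> I m k \<in> Lambda_k P l" using I_Lambda unfolding Lambda_def by blast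
  then obtain lev where lev: "\<And>m k. k \<in> {1..nn m} \<Longrightarrow> I m k \<in> Lambda_k P (lev m k)" by metis
  \<comment> \<open>Since \<open>mprod (P j) K\<close> exceeds \<open>K\<close>, the maximal index
    itself is a sufficient level.\<close>
  define K where "K = Max (range n)"
  have nK: "\<forall>j. n j < mprod (P j) K"
  proof
    fix j
    have "n j \<le> K" unfolding K_def by (intro Max_ge) auto
    then show "n j < mprod (P j) K" using R.mprod_gt[where j = j and k = K] by simp
  qed
  define M where "M = haar_supnorm P n"
  define g where "g m x = trunc (f x * cnj (haar_multi P n x)) (M * h m x)" for m x
  \<comment> \<open>Independent of \<open>m\<close>, so the error tends to zero with
    \<open>\<epsilon> m\<close>.\<close>
  define D where "D = 2 * M * (1 / \<gamma> + 1) * C\<^sup>2"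
  have est: "norm (set_lebesgue_integral lebesgue ?X (g m) - a n) \<le> D * \<epsilon> m"
    if small: "C\<^sup>2 * \<epsilon> m \<le> \<gamma> * (\<delta> * cell_vol P K)" for m
  proof -
    have hI: "set_lebesgue_integral lebesgue (I m k) (h' m) = set_lebesgue_integral lebesgue (I m k) (h m)"
      if "k \<in> {1..nn m}" for k
      unfolding set_lebesgue_integral_def using I_sub[OF that]
      by (intro Bochner_Integration.integral_cong) (auto simp: h'_def split: split_indicator)
    have "norm (a n - set_lebesgue_integral lebesgue ?X (\<lambda>x. trunc (f' x * cnj (haar_multi P n x)) (haar_supnorm P n * h' m x)))
      \<le> 2 * haar_supnorm P n * (1 / \<gamma> + 1) * (C\<^sup>2 * \<epsilon> m)"
      unfolding \<epsilon>_def E_def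
    proof (rule coefficient_estimate[OF \<gamma>(1,2) \<gamma>_vol f'_meas conv' h'_meas h'0 nK _ _ _ I_Un[of m] _ C \<delta>])
      show "I m k \<in> Lambda_k P (lev m k)" if "k \<in> {1..nn m}" for k by (rule lev[OF that])
      show "h' m x \<le> C * h' m y" if "k \<in> {1..nn m}" "x \<in> I m k" "y \<in> I m k" for k x y
        using I_comp[OF that] I_sub[OF that(1)] that(2,3) by (auto simp: h'_def)
      show "\<delta> \<le> set_lebesgue_integral lebesgue (I m k) (h' m)" if "k \<in> {1..nn m}" for k
        using I_mass[OF that] hI[OF that] by simp
      show "C\<^sup>2 * set_lebesgue_integral lebesgue {x \<in> ?X. ereal (h' m x) < haar_Psi_star P a x} (h' m)
        \<le> \<gamma> * (\<delta> * cell_vol P K)"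
        using small by (simp add: \<epsilon>_def E_def)
    qed (use I_disj in auto)
    moreover have "set_lebesgue_integral lebesgue ?X (\<lambda>x. trunc (f' x * cnj (haar_multi P n x)) (haar_supnorm P n * h' m x))
      = set_lebesgue_integral lebesgue ?X (g m)"
      unfolding set_lebesgue_integral_def
      by (intro Bochner_Integration.integral_cong) (auto simp: h'_def f'_def g_def M_def split: split_indicator)
    ultimately show ?thesis by (simp add: norm_minus_commute D_def M_def mult.assoc)
  qed
  have "(\<lambda>m. set_lebesgue_integral lebesgue ?X (g m) - a n) \<longlonglongrightarrow> 0"
  proof (rule Lim_null_comparison)
    have "(\<lambda>m. C\<^sup>2 * \<epsilon> m) \<longlonglongrightarrow> C\<^sup>2 * 0" by (intro tendsto_intros \<epsilon>_lim)
    \<comment> \<open>The right-hand side of the smallness condition is positive and does not depend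
      on \<open>m\<close>, so the condition holds for all large \<open>m\<close>.\<close>
    then have "eventually (\<lambda>m. C\<^sup>2 * \<epsilon> m < \<gamma> * (\<delta> * cell_vol P K)) sequentially"
      using \<gamma>(1) \<delta> cell_vol_pos[of K] by (intro order_tendstoD(2)[where y = "C\<^sup>2 * 0"]) auto
    then show "eventually (\<lambda>m. norm (set_lebesgue_integral lebesgue ?X (g m) - a n) \<le> D * \<epsilon> m) sequentially"
      by eventually_elim (simp add: est)
    show "(\<lambda>m. D * \<epsilon> m) \<longlonglongrightarrow> 0" using tendsto_mult_right_zero[OF \<epsilon>_lim] .
  qed
  then have "(\<lambda>m. set_lebesgue_integral lebesgue ?X (g m)) \<longlonglongrightarrow> a n" by (rule LIM_zero_cancel)
  then show "(\<lambda>m. set_lebesgue_integral lebesgue (cbox 0 1)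
              (\<lambda>x. trunc (f x * cnj (haar_multi P n x)) (haar_supnorm P n * h m x))) \<longlonglongrightarrow> a n"
    by (simp add: g_def[abs_def] M_def)
qed

end
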